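(* Let $n,p,k,i$ be integers with $n\ge0$, $p\ge1$, $k\in\{2,3,4\}$ and $k>i\ge1$. Then \begin{align*} &\sum_{m_p\geq \dots\geq m_{1}\geq 0} \frac{q^{m_p^2+\dots+m_1^2}(q;q)_{2n}}{(q;q)_{n-m_p}(q;q)_{m_p - m_{p-1}}\cdots (q;q)_{m_2-m_1}(q;q)_{2m_1}} \sum_{n_1\geq \dots\geq n_{k-1}\geq n_k=0} q^{n_1^2+\dots+n_{k-1}^2 + n_i+\dots +n_{k-1}} \prod_{j=1}^{k-1} {2m_1- 2\sum_{l=1}^{j-1}n_l -n_j - n_{j+1} -2 \alpha_{ij} \brack n_j - n_{j+1}}'_q \\ &= \sum_{r=-\infty}^{\infty} (-1)^r q^{\frac{r( (2k+1)r + 2k-2i +1)}{2}+p\left(\frac{(2k+1)r}{2} - (2k-2i+1)\frac{(-1)^r-1}{4}\right)^2} {2n\brack n - \frac{(2k+1)r}{2} + (2k-2i+1)\frac{(-1)^r-1}{4}}_q. \end{align*}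
   Context: $\alpha_{ij}:=\max\{j-i+1,0\}$. $(a;q)_m=\prod_{j=0}^{m-1}(1-aq^j)$ for $m\ge0$ and $1/(q;q)_m:=0$ for $m<0$. The outer sum is over integers $m_p\ge\dots\ge m_1\ge0$ (for $p=1$ the denominator is $(q;q)_{n-m_1}(q;q)_{2m_1}$); the inner sum is over integers $n_1\ge\dots\ge n_{k-1}\ge0$ with $n_k:=0$. For integers $a,b$, ${a\brack b}_q=\frac{(q;q)_a}{(q;q)_b(q;q)_{a-b}}$ if $0\le b\le a$ and $0$ otherwise; ${a\brack b}'_q$ equals $1$ if $a<0$ and $b=0$, and ${a\brack b}_q$ otherwise. *)

theory Defs
  imports Complex_Main
begin

definition qpoch :: "'a::field \<Rightarrow> 'a \<Rightarrow> nat \<Rightarrow> 'a"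
  where "qpoch a q m = (\<Prod>j<m. 1 - a * q ^ j)"

definition inv_qfact :: "'a::field \<Rightarrow> int \<Rightarrow> 'a"
  where "inv_qfact q m = (if m < 0 then 0 else 1 / qpoch q q (nat m))"

definition qbinom :: "'a::field \<Rightarrow> int \<Rightarrow> int \<Rightarrow> 'a"
  where "qbinom q a b =
    (if 0 \<le> b \<and> b \<le> a
     then qpoch q q (nat a) / (qpoch q q (nat b) * qpoch q q (nat (a - b)))
     else 0)"

definition qbinom' :: "'a::field \<Rightarrow> int \<Rightarrow> int \<Rightarrow> 'a"
  where "qbinom' q a b = (if a < 0 \<and> b = 0 then 1 else qbinom q a b)"

definition \<alpha> :: "nat \<Rightarrow> nat \<Rightarrow> int"
  where "\<alpha> i j = max (int j - int i + 1) 0"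

text \<open>
  A tuple is a function on the naturals, indexed from 1 and equal to 0 outside its index range.
  In particular every \<^term>\<open>\<nu>\<close> in \<open>decr_tuples (k - 1)\<close> satisfies \<^term>\<open>\<nu> k = 0\<close>.
\<close>

definition incr_tuples :: "nat \<Rightarrow> (nat \<Rightarrow> nat) set"
  where "incr_tuples l =
    {m. (\<forall>j. j \<notin> {1..l} \<longrightarrow> m j = 0) \<and> (\<forall>j\<in>{1..<l}. m j \<le> m (j + 1))}"

definition decr_tuples :: "nat \<Rightarrow> (nat \<Rightarrow> nat) set"
  where "decr_tuples l =
    {\<nu>. (\<forall>j. j \<notin> {1..l} \<longrightarrow> \<nu> j = 0) \<and> (\<forall>j\<in>{1..<l}. \<nu> (j + 1) \<le> \<nu> j)}"

text \<open>
  The next two quantities are integers; the floor and the integer division only serve to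
  give them the right type, as the two lemmas following them show.
\<close>

definition shift :: "nat \<Rightarrow> nat \<Rightarrow> int \<Rightarrow> int"
  where "shift k i r =
    \<lfloor>(2 * of_nat k + 1) * of_int r / 2
      - (2 * of_nat k - 2 * of_nat i + 1) * ((-1) powi r - 1) / 4 :: rat\<rfloor>"

definition quad :: "nat \<Rightarrow> nat \<Rightarrow> int \<Rightarrow> int"
  where "quad k i r = r * ((2 * int k + 1) * r + 2 * int k - 2 * int i + 1) div 2"

lemma of_int_shift:
  "(of_int (shift k i r) :: rat) =
    (2 * of_nat k + 1) * of_int r / 2 - (2 * of_nat k - 2 * of_nat i + 1) * ((-1) powi r - 1) / 4"
proof (cases "even r")
  case True
  then obtain s where "r = 2 * s" by (elim evenE)
  then have "(2 * of_nat k + 1) * of_int r / 2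
      - (2 * of_nat k - 2 * of_nat i + 1) * ((-1) powi r - 1) / 4
      = (of_int ((2 * int k + 1) * s) :: rat)"
    by (simp add: power_int_minus_left)
  then show ?thesis unfolding shift_def by simp
next
  case False
  then obtain s where "r = 2 * s + 1" by (elim oddE)
  then have "(2 * of_nat k + 1) * of_int r / 2
      - (2 * of_nat k - 2 * of_nat i + 1) * ((-1) powi r - 1) / 4
      = (of_int ((2 * int k + 1) * s + 2 * int k - int i + 1) :: rat)"
    by (simp add: power_int_minus_left field_simps)
  then show ?thesis unfolding shift_def by simp
qed

lemma two_times_quad:
  "2 * quad k i r = r * ((2 * int k + 1) * r + 2 * int k - 2 * int i + 1)"
proof -
  have "even (r * ((2 * int k + 1) * r + 2 * int k - 2 * int i + 1))" by auto
  then show ?thesis unfolding quad_def by simp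
qed

text \<open>
  All three sums of the identity have only finitely many nonzero terms, so that
  \<^const>\<open>sum'\<close> computes the intended value.
\<close>

lemma finite_bounded_tuples:
  "finite {m :: nat \<Rightarrow> nat. (\<forall>j. j \<notin> {1..l} \<longrightarrow> m j = 0) \<and> (\<forall>j\<in>{1..l}. m j \<le> b)}"
proof -
  have "{m :: nat \<Rightarrow> nat. (\<forall>j. j \<notin> {1..l} \<longrightarrow> m j = 0) \<and> (\<forall>j\<in>{1..l}. m j \<le> b)}
    = {m. \<forall>j. (j \<in> {1..l} \<longrightarrow> m j \<in> {..b}) \<and> (j \<notin> {1..l} \<longrightarrow> m j = 0)}"
    by auto
  then show ?thesis by (simp only: finite_set_of_finite_funs finite_atLeastAtMost finite_atMost)
qed

lemma finite_outer_support:
  "finite {m \<in> incr_tuples p. inv_qfact q (int n - int (m p)) \<noteq> 0}"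
proof (rule finite_subset[OF _ finite_bounded_tuples[of p n]], safe)
  fix m j
  assume m: "m \<in> incr_tuples p" and nz: "inv_qfact q (int n - int (m p)) \<noteq> 0"
  show "m j = 0" if "j \<notin> {1..p}"
    using m that by (auto simp: incr_tuples_def)
  assume j: "j \<in> {1..p}"
  from j have "j \<le> p" by simp
  then have "m j \<le> m p"
    using m j
    by (induction rule: inc_induct) (auto simp: incr_tuples_def intro: le_trans)
  moreover have "m p \<le> n" using nz by (auto simp: inv_qfact_def split: if_splits)
  ultimately show "m j \<le> n" by simp
qed

lemma finite_inner_support:
  "finite {\<nu> \<in> decr_tuples (k - 1). (\<Prod>j=1..k-1.
      qbinom' q (2 * int M - 2 * (\<Sum>l=1..j-1. int (\<nu> l)) - int (\<nu> j) - int (\<nu> (j + 1)) - 2 * \<alpha> i j)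
        (int (\<nu> j) - int (\<nu> (j + 1)))) \<noteq> 0}"
proof (rule finite_subset[OF _ finite_bounded_tuples[of "k - 1" M]], safe)
  fix \<nu> j
  assume d: "\<nu> \<in> decr_tuples (k - 1)" and nz: "(\<Prod>j=1..k-1.
      qbinom' q (2 * int M - 2 * (\<Sum>l=1..j-1. int (\<nu> l)) - int (\<nu> j) - int (\<nu> (j + 1)) - 2 * \<alpha> i j)
        (int (\<nu> j) - int (\<nu> (j + 1)))) \<noteq> 0"
  show z: "\<nu> j = 0" if "j \<notin> {1..k-1}" for j
    using d that by (auto simp: decr_tuples_def)
  assume j: "j \<in> {1..k-1}"
  have step: "\<nu> l = \<nu> (l + 1) \<or> \<nu> l \<le> M" if l: "l \<in> {1..k-1}" for l
  proof (rule disjCI)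
    assume "\<not> \<nu> l \<le> M"
    have "qbinom' q (2 * int M - 2 * (\<Sum>a=1..l-1. int (\<nu> a)) - int (\<nu> l) - int (\<nu> (l + 1)) - 2 * \<alpha> i l)
        (int (\<nu> l) - int (\<nu> (l + 1))) \<noteq> 0"
      using nz l by (simp add: prod_zero_iff)
    moreover have "(\<Sum>a=1..l-1. int (\<nu> a)) \<ge> 0" by (rule sum_nonneg) simp
    moreover have "\<alpha> i l \<ge> 0" by (simp add: \<alpha>_def)
    ultimately show "\<nu> l = \<nu> (l + 1)"
      using \<open>\<not> \<nu> l \<le> M\<close> by (auto simp: qbinom'_def qbinom_def split: if_splits)
  qed
  have "j \<le> k" using j by auto
  then show "\<nu> j \<le> M"
    using j
  proof (induction rule: inc_induct)
    case base
    then show ?case by auto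
  next
    case (step a)
    then have "a + 1 = k \<or> a + 1 \<in> {1..k-1}" by auto
    moreover have "\<nu> k = 0" using z[of k] by (cases k) auto
    ultimately have "\<nu> (a + 1) \<le> M" using step by auto
    then show ?case using \<open>\<And>l. l \<in> {1..k-1} \<Longrightarrow> \<nu> l = \<nu> (l + 1) \<or> \<nu> l \<le> M\<close>[OF step.prems] by auto
  qed
qed

lemma finite_right_support:
  "finite {r. qbinom q (2 * int n) (int n - shift k i r) \<noteq> 0}"
proof -
  define c where "c = int n + \<bar>2 * int k - 2 * int i + 1\<bar>"
  have "r \<in> {- 2 * c..2 * c}" if nz: "qbinom q (2 * int n) (int n - shift k i r) \<noteq> 0" for r
  proof -
    define e :: int where "e = (if even r then 0 else 1)"
    have "(of_int (4 * shift k i r) :: rat) = of_int (2 * (2 * int k + 1) * r + 2 * (2 * int k - 2 * int i + 1) * e)"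
      by (simp add: of_int_shift power_int_minus_left e_def field_simps)
    then have eq: "4 * shift k i r = 2 * (2 * int k + 1) * r + 2 * (2 * int k - 2 * int i + 1) * e"
      by (simp only: of_int_eq_iff)
    then have "\<bar>(2 * int k + 1) * r\<bar> = \<bar>2 * shift k i r - (2 * int k - 2 * int i + 1) * e\<bar>"
      by (simp add: algebra_simps)
    also have "\<dots> \<le> \<bar>2 * shift k i r\<bar> + \<bar>(2 * int k - 2 * int i + 1) * e\<bar>"
      by (rule abs_triangle_ineq4)
    also have "\<dots> \<le> 2 * int n + 2 * \<bar>2 * int k - 2 * int i + 1\<bar>"
    proof (rule add_mono)
      show "\<bar>2 * shift k i r\<bar> \<le> 2 * int n"
        using nz by (auto simp: qbinom_def split: if_splits)
      show "\<bar>(2 * int k - 2 * int i + 1) * e\<bar> \<le> 2 * \<bar>2 * int k - 2 * int i + 1\<bar>"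
        by (simp add: e_def)
    qed
    also have "\<dots> = 2 * c" by (simp add: c_def)
    finally have "\<bar>(2 * int k + 1) * r\<bar> \<le> 2 * c" .
    moreover have "1 * \<bar>r\<bar> \<le> (2 * int k + 1) * \<bar>r\<bar>"
      by (rule mult_right_mono) auto
    ultimately have "\<bar>r\<bar> \<le> 2 * c" by (simp add: abs_mult)
    then show ?thesis by auto
  qed
  then have "{r. qbinom q (2 * int n) (int n - shift k i r) \<noteq> 0} \<subseteq> {- 2 * c..2 * c}" by blast
  then show ?thesis by (rule finite_subset) simp
qed

end

theory Submission
  imports Defs
begin

text \<open>
  The Bailey lemma (\<open>bailey_sum\<close>) turns the sum over each of \<open>m\<^sub>1, \<dots>, m\<^sub>p\<close> into a factor
  \<open>q\<close> to the square of the shift, so everything reduces to the case \<open>p = 0\<close>, in which the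
  inner sum with \<open>M = m\<^sub>1\<close> has to equal the alternating sum of
  \<open>q\<close>-binomials \<open>[2M, M - shift]\<close>.

  For that identity one carries a second length parameter \<open>N\<close> and replaces the binomial
  \<open>[2L, L - a]\<close> by \<open>burge_prod L N a b = [L + N + a - b, L + a] [L + N - a + b, L - a]\<close>.
  A form of the \<open>q\<close>-Saalschuetz sum, the Burge transform, sends \<open>(a, b)\<close> to \<open>(a + b, b)\<close> and
  contributes \<open>q\<close> to the \<open>b\<^sup>2\<close>. With \<open>b = r\<close> it raises both \<open>k\<close> and \<open>i\<close> by one on the
  alternating side, while on the other side it performs the summation over one of the
  variables \<open>n\<^sub>j\<close> with \<open>j < i\<close>. For \<open>j \<ge> i\<close> one needs in addition that the alternating sum with
  \<open>i = 0\<close> at length \<open>L\<close> is \<open>q\<close> to the \<open>N\<close> times the one with \<open>i = 1\<close> at length \<open>L - 1\<close>: by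
  Pascal's rule the difference is an odd function of the summation index. The argument is
  uniform in \<open>k\<close>. Negative powers of \<open>q\<close> occur on the way, so \<open>q = 0\<close> is treated separately.
\<close>

subsection \<open>The Burge transform\<close>

lemma abs_diff_le_abs_add: "(a::int) * b \<ge> 0 \<Longrightarrow> \<bar>a - b\<bar> \<le> \<bar>a + b\<bar>"
  by (auto simp: zero_le_mult_iff)

lemma sum_int_atLeast0: "(\<Sum>r\<in>{0..int N}. f r) = (\<Sum>r\<le>N. f (int r))"
  by (rule sum.reindex_bij_witness[of _ int nat]) auto

text \<open>Nonzero \<open>q\<close> lets \<open>powi\<close> add exponents of either sign, and
  \<open>q_power_neq_1\<close> makes every \<open>qpoch q q m\<close> invertible.\<close>

locale generic_q =
  fixes q :: "'a::field"
  assumes q_nonzero: "q \<noteq> 0"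
    and q_power_neq_1: "\<And>j. j \<ge> 1 \<Longrightarrow> q ^ j \<noteq> 1"
begin

section \<open>Recurrences for q-factorials and Gaussian binomials\<close>

lemma qpoch_Suc: "qpoch q q (Suc m) = qpoch q q m * (1 - q ^ Suc m)"
  by (simp add: qpoch_def)

lemma qpoch_nonzero: "qpoch q q m \<noteq> 0"
  using q_power_neq_1[of "Suc _"] by (auto simp: qpoch_def simp flip: power_Suc)

text \<open>The convention 1/(q;q)_m = 0 for m < 0 makes the recurrence valid at every integer: at m
  = 0 the factor 1 - q^0 vanishes. This spares case distinctions in later sums.\<close>

lemma inv_qfact_rec: "inv_qfact q (m - 1) = (1 - q powi m) * inv_qfact q m"
proof (cases "m \<ge> 1")
  case True
  then obtain l where l: "m = int (Suc l)"
    using that[of "nat (m - 1)"] by simp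
  then have "nat m = Suc l" "nat (m - 1) = l" by auto
  moreover have "1 - q ^ Suc l \<noteq> 0" using q_power_neq_1[of "Suc l"] by simp
  ultimately show ?thesis
    using True l qpoch_nonzero[of l] by (simp add: inv_qfact_def qpoch_Suc del: power_Suc of_nat_Suc)
next
  case False
  then consider "m = 0" | "m < 0" by linarith
  then show ?thesis by cases (simp_all add: inv_qfact_def)
qed

lemma qbinom_eq_inv_qfact:
  "a \<ge> 0 \<Longrightarrow> qbinom q a b = qpoch q q (nat a) * inv_qfact q b * inv_qfact q (a - b)"
  by (auto simp: qbinom_def inv_qfact_def)

lemma qbinom_neg: "a < 0 \<Longrightarrow> qbinom q a b = 0"
  by (simp add: qbinom_def)

lemma qbinom_0_left: "qbinom q 0 b = (if b = 0 then 1 else 0)"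
  by (simp add: qbinom_def qpoch_def)

lemma qbinom_0_right: "qbinom q a 0 = (if a \<ge> 0 then 1 else 0)"
  using qpoch_nonzero by (simp add: qbinom_def, simp add: qpoch_def)

lemma qbinom_eq_0: "b < 0 \<or> a < b \<Longrightarrow> qbinom q a b = 0"
  by (auto simp: qbinom_def)

lemma qbinom_sym: "qbinom q a (a - b) = qbinom q a b"
  by (auto simp: qbinom_def)

text \<open>For a >= 1 this is (1 - q^b) + q^b (1 - q^(a-b)) = 1 - q^a. The only exception is a = b
  = 0, where the left side is 1 while both binomials on the right have upper entry -1 and
  vanish.\<close>

lemma qbinom_Pascal:
  assumes "a \<noteq> 0 \<or> b \<noteq> 0"
  shows "qbinom q a b = qbinom q (a - 1) (b - 1) + q powi b * qbinom q (a - 1) b"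
proof -
  consider "a < 0" | "a = 0" | "a \<ge> 1" by linarith
  then show ?thesis
  proof cases
    case 3
    then have "nat a = Suc (nat (a - 1))" by simp
    then have Q: "qpoch q q (nat a) = qpoch q q (nat (a - 1)) * (1 - q powi a)"
      using 3 by (simp add: qpoch_Suc power_int_def del: power_Suc)
    have e: "q powi a = q powi b * q powi (a - b)"
      using q_nonzero by (simp flip: power_int_add)
    have i1: "inv_qfact q (b - 1) = (1 - q powi b) * inv_qfact q b"
      by (rule inv_qfact_rec)
    have i2: "inv_qfact q (a - 1 - b) = (1 - q powi (a - b)) * inv_qfact q (a - b)"
      using inv_qfact_rec[of "a - b"] by (simp add: algebra_simps)
    have "qbinom q (a - 1) (b - 1) + q powi b * qbinom q (a - 1) b
        = qpoch q q (nat (a - 1)) * (inv_qfact q (b - 1) * inv_qfact q (a - b)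
            + q powi b * (inv_qfact q b * inv_qfact q (a - 1 - b)))"
      using 3 by (simp add: qbinom_eq_inv_qfact algebra_simps)
    also have "\<dots> = qbinom q a b"
      using 3 unfolding i1 i2 qbinom_eq_inv_qfact[of a, OF order_trans[OF zero_le_one 3]] Q e
      by (simp add: algebra_simps)
    finally show ?thesis ..
  qed (use assms in \<open>auto simp: qbinom_neg qbinom_0_left\<close>)
qed

lemma qbinom_Pascal':
  assumes "a \<noteq> 0 \<or> b \<noteq> 0"
  shows "qbinom q a b = qbinom q (a - 1) b + q powi (a - b) * qbinom q (a - 1) (b - 1)"
proof -
  have "qbinom q a (a - b) = qbinom q (a - 1) (a - b - 1) + q powi (a - b) * qbinom q (a - 1) (a - b)"
    by (rule qbinom_Pascal) (use assms in auto)
  then show ?thesis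
    using qbinom_sym[of a b] qbinom_sym[of "a - 1" b] qbinom_sym[of "a - 1" "b - 1"]
    by (simp add: algebra_simps)
qed

section \<open>Trinomial revision, q-Vandermonde and q-Saalschuetz sums\<close>

lemma qbinom_trinomial:
  "qbinom q x c * qbinom q c m = qbinom q x m * qbinom q (x - m) (c - m)"
proof (cases "0 \<le> m \<and> m \<le> c \<and> c \<le> x")
  case True
  then show ?thesis
    using qpoch_nonzero[of "nat c"] qpoch_nonzero[of "nat (x - m)"] by (simp add: qbinom_def)
next
  case False
  then have "qbinom q x c = 0 \<or> qbinom q c m = 0" "qbinom q x m = 0 \<or> qbinom q (x - m) (c - m) = 0"
    by (auto simp: qbinom_def)
  then show ?thesis by auto
qed

text \<open>Pascal's rule for [x + 1, k] gives two sums: the first becomes the case n - 1 after a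
  shift of k by one, the second gains q^n, and Pascal's rule for [x + 1 + y, n] reunites them. The
  range \<open>S\<close> may be any finite superset of 0..x, so that translated and reflected ranges
  can be used directly.\<close>

lemma qbinom_Vandermonde:
  fixes y n :: int and S :: "int set"
  assumes "y \<ge> 0" "finite S" "{0..int x} \<subseteq> S"
  shows "(\<Sum>k\<in>S. q powi ((int x - k) * (n - k)) * qbinom q (int x) k * qbinom q y (n - k))
    = qbinom q (int x + y) n"
  using assms(2,3)
proof (induction x arbitrary: S n)
  case 0
  have "(\<Sum>k\<in>S. q powi ((int 0 - k) * (n - k)) * qbinom q (int 0) k * qbinom q y (n - k))
      = (\<Sum>k\<in>{0}. q powi ((int 0 - k) * (n - k)) * qbinom q (int 0) k * qbinom q y (n - k))"
    by (rule sum.mono_neutral_right) (use 0 in \<open>auto simp: qbinom_0_left\<close>)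
  then show ?case by (simp add: qbinom_0_left)
next
  case (Suc x)
  have P: "qbinom q (int (Suc x)) k = qbinom q (int x) (k - 1) + q powi k * qbinom q (int x) k" for k
    using qbinom_Pascal[of "int (Suc x)" k] by simp
  have e: "q powi ((int (Suc x) - k) * (n - k)) * q powi k
      = q powi n * q powi ((int x - k) * (n - k))" for k
    using q_nonzero by (simp flip: power_int_add) (simp add: algebra_simps)
  have "(\<Sum>k\<in>S. q powi ((int (Suc x) - k) * (n - k)) * qbinom q (int (Suc x)) k * qbinom q y (n - k))
      = (\<Sum>k\<in>S. q powi ((int (Suc x) - k) * (n - k)) * qbinom q (int x) (k - 1) * qbinom q y (n - k))
        + (\<Sum>k\<in>S. (q powi ((int (Suc x) - k) * (n - k)) * q powi k) * qbinom q (int x) k * qbinom q y (n - k))"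
    unfolding P by (simp add: algebra_simps sum.distrib)
  also have "(\<Sum>k\<in>S. q powi ((int (Suc x) - k) * (n - k)) * qbinom q (int x) (k - 1) * qbinom q y (n - k))
      = (\<Sum>k\<in>(\<lambda>k. k - 1) ` S. q powi ((int x - k) * (n - 1 - k)) * qbinom q (int x) k * qbinom q y (n - 1 - k))"
    by (subst sum.reindex) (auto simp: inj_on_def algebra_simps intro!: sum.cong)
  also have "\<dots> = qbinom q (int x + y) (n - 1)"
  proof (rule Suc.IH)
    show "{0..int x} \<subseteq> (\<lambda>k. k - 1) ` S"
    proof
      fix k assume "k \<in> {0..int x}"
      then have "k + 1 \<in> S" using Suc.prems(2) by auto
      then show "k \<in> (\<lambda>k. k - 1) ` S" by (rule rev_image_eqI) simp
    qed
  qed (use Suc.prems in auto)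
  also have "(\<Sum>k\<in>S. (q powi ((int (Suc x) - k) * (n - k)) * q powi k) * qbinom q (int x) k * qbinom q y (n - k))
      = q powi n * (\<Sum>k\<in>S. q powi ((int x - k) * (n - k)) * qbinom q (int x) k * qbinom q y (n - k))"
    unfolding e by (simp add: sum_distrib_left mult.assoc)
  also have "\<dots> = q powi n * qbinom q (int x + y) n"
    by (subst Suc.IH) (use Suc.prems in auto)
  finally show ?case
    using qbinom_Pascal[of "int (Suc x) + y" n] assms(1) by (simp add: add_ac)
qed

lemma qbinom_Vandermonde_int:
  fixes x y n :: int and S :: "int set"
  assumes "x \<ge> 0" "y \<ge> 0" "finite S" "{0..x} \<subseteq> S"
  shows "(\<Sum>k\<in>S. q powi ((x - k) * (n - k)) * qbinom q x k * qbinom q y (n - k)) = qbinom q (x + y) n"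
  using qbinom_Vandermonde[of y S "nat x" n] assms by simp

lemma qbinom_Vandermonde_dual:
  fixes x y n :: int and S :: "int set"
  assumes "x \<ge> 0" "y \<ge> 0" "finite S" "{0..x} \<subseteq> S"
  shows "(\<Sum>k\<in>S. q powi (k * (y - n + k)) * qbinom q x k * qbinom q y (n - k)) = qbinom q (x + y) n"
proof -
  \<comment> \<open>The reflection k -> n - k exchanges x and y, so the range must also cover the
    reflection of 0..y.\<close>
  define R where "R = S \<union> (\<lambda>k. n - k) ` {0..y}"
  have "(\<Sum>k\<in>S. q powi (k * (y - n + k)) * qbinom q x k * qbinom q y (n - k))
      = (\<Sum>k\<in>R. q powi (k * (y - n + k)) * qbinom q x k * qbinom q y (n - k))"
    by (rule sum.mono_neutral_left) (use assms in \<open>auto simp: R_def subset_iff qbinom_def\<close>)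
  also have "\<dots> = (\<Sum>k\<in>(\<lambda>k. n - k) ` R. q powi ((y - k) * (n - k)) * qbinom q y k * qbinom q x (n - k))"
    by (subst sum.reindex) (auto simp: inj_on_def algebra_simps intro!: sum.cong)
  also have "\<dots> = qbinom q (y + x) n"
    by (rule qbinom_Vandermonde_int) (use assms in \<open>auto simp: R_def image_Un image_image\<close>)
  finally show ?thesis by (simp add: add.commute)
qed

text \<open>
  Expand the last binomial by Vandermonde in \<open>x\<close> and \<open>k\<close>; after trinomial revision the
  sums over \<open>k\<close> and then over the expansion index are again Vandermonde sums.
\<close>

lemma qbinom_Saalschuetz:
  fixes A B x n :: int and S :: "int set"
  assumes "A \<ge> 0" "B \<ge> 0" "x \<ge> 0" "finite S" "{0..A} \<subseteq> S"
  shows "(\<Sum>k\<in>S. q powi ((A - k) * (n - k)) * qbinom q A k * qbinom q B (n - k) * qbinom q (x + k) (A + B))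
    = qbinom q x (A + B - n) * qbinom q (x + n - B) n"
proof -
  define m where "m = A + B - n"
  have "(\<Sum>k\<in>S. q powi ((A - k) * (n - k)) * qbinom q A k * qbinom q B (n - k) * qbinom q (x + k) (A + B))
      = (\<Sum>k\<in>{0..A}. q powi ((A - k) * (n - k)) * qbinom q A k * qbinom q B (n - k) * qbinom q (x + k) (A + B))"
    by (rule sum.mono_neutral_right) (use assms in \<open>auto simp: qbinom_def\<close>)
  also have "\<dots> = (\<Sum>k\<in>{0..A}. \<Sum>j\<in>{0..A}. q powi ((A - k) * (n - k)) * qbinom q A k * qbinom q B (n - k) *
      (q powi (j * (x - (A + B) + j)) * qbinom q k j * qbinom q x (A + B - j)))"
  proof (intro sum.cong refl)
    fix k assume k: "k \<in> {0..A}"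
    have "qbinom q (x + k) (A + B) = (\<Sum>j\<in>{0..A}. q powi (j * (x - (A + B) + j)) * qbinom q k j * qbinom q x (A + B - j))"
      by (subst qbinom_Vandermonde_dual) (use k assms in \<open>auto simp: add.commute\<close>)
    then show "q powi ((A - k) * (n - k)) * qbinom q A k * qbinom q B (n - k) * qbinom q (x + k) (A + B)
      = (\<Sum>j\<in>{0..A}. q powi ((A - k) * (n - k)) * qbinom q A k * qbinom q B (n - k) *
      (q powi (j * (x - (A + B) + j)) * qbinom q k j * qbinom q x (A + B - j)))"
      by (simp add: sum_distrib_left)
  qed
  also have "\<dots> = (\<Sum>j\<in>{0..A}. \<Sum>k\<in>{0..A}. q powi ((A - k) * (n - k)) * qbinom q A k * qbinom q B (n - k) *
      (q powi (j * (x - (A + B) + j)) * qbinom q k j * qbinom q x (A + B - j)))"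
    by (rule sum.swap)
  also have "\<dots> = (\<Sum>j\<in>{0..A}. qbinom q x m * (q powi (j * ((x - m) - n + j)) * qbinom q A j * qbinom q (x - m) (n - j)))"
  proof (intro sum.cong refl)
    fix j assume j: "j \<in> {0..A}"
    have "(\<Sum>k\<in>{0..A}. q powi ((A - k) * (n - k)) * qbinom q A k * qbinom q B (n - k) *
        (q powi (j * (x - (A + B) + j)) * qbinom q k j * qbinom q x (A + B - j)))
      = (\<Sum>k\<in>{0..A}. q powi ((A - k) * (n - k)) * (qbinom q A k * qbinom q k j) * qbinom q B (n - k) *
        (q powi (j * (x - (A + B) + j)) * qbinom q x (A + B - j)))"
      by (simp add: mult_ac)
    also have "\<dots> = q powi (j * (x - (A + B) + j)) * qbinom q A j * qbinom q x (A + B - j)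
        * (\<Sum>k\<in>{0..A}. q powi ((A - k) * (n - k)) * qbinom q (A - j) (k - j) * qbinom q B (n - k))"
      unfolding qbinom_trinomial by (simp add: sum_distrib_left mult_ac)
    also have "(\<Sum>k\<in>{0..A}. q powi ((A - k) * (n - k)) * qbinom q (A - j) (k - j) * qbinom q B (n - k))
        = (\<Sum>k\<in>(\<lambda>k. k - j) ` {0..A}. q powi ((A - j - k) * (n - j - k)) * qbinom q (A - j) k * qbinom q B (n - j - k))"
      by (subst sum.reindex) (auto simp: inj_on_def intro!: sum.cong)
    also have "\<dots> = qbinom q (A - j + B) (n - j)"
    proof (rule qbinom_Vandermonde_int)
      show "{0..A - j} \<subseteq> (\<lambda>k. k - j) ` {0..A}"
        using j by (auto simp: image_iff intro!: bexI[of _ "_ + j"])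
    qed (use j assms in auto)
    also have "\<dots> = qbinom q (A + B - j) m"
      using qbinom_sym[of "A + B - j" m] by (simp add: m_def algebra_simps)
    also have "q powi (j * (x - (A + B) + j)) * qbinom q A j * qbinom q x (A + B - j) * qbinom q (A + B - j) m
        = q powi (j * (x - (A + B) + j)) * qbinom q A j * (qbinom q x (A + B - j) * qbinom q (A + B - j) m)"
      by (simp add: mult_ac)
    also have "\<dots> = qbinom q x m * (q powi (j * ((x - m) - n + j)) * qbinom q A j * qbinom q (x - m) (n - j))"
      unfolding qbinom_trinomial by (simp add: m_def algebra_simps)
    finally show "(\<Sum>k\<in>{0..A}. q powi ((A - k) * (n - k)) * qbinom q A k * qbinom q B (n - k) *
        (q powi (j * (x - (A + B) + j)) * qbinom q k j * qbinom q x (A + B - j))) = \<dots>" .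
  qed
  also have "\<dots> = qbinom q x m * (\<Sum>j\<in>{0..A}. q powi (j * ((x - m) - n + j)) * qbinom q A j * qbinom q (x - m) (n - j))"
    by (simp add: sum_distrib_left)
  also have "\<dots> = qbinom q x m * qbinom q (x + n - B) n"
  \<comment> \<open>The dual Vandermonde sum needs x - m >= 0; otherwise the common factor [x, m] is
    already 0.\<close>
  proof (cases "m \<le> x")
    case True
    then show ?thesis
      by (subst qbinom_Vandermonde_dual) (use assms in \<open>auto simp: m_def algebra_simps\<close>)
  qed (simp add: qbinom_eq_0)
  finally show ?thesis by (simp add: m_def)
qed

section \<open>The Burge product and its transform\<close>

definition burge_prod :: "int \<Rightarrow> int \<Rightarrow> int \<Rightarrow> int \<Rightarrow> 'a"
  where "burge_prod L N a b = qbinom q (L + N + a - b) (L + a) * qbinom q (L + N - a + b) (L - a)"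

lemma burge_prod_eq_0: "\<bar>b\<bar> > N \<or> \<bar>a\<bar> > L \<Longrightarrow> burge_prod L N a b = 0"
  by (auto simp: burge_prod_def qbinom_def)

lemma burge_prod_neg: "L < 0 \<or> N < 0 \<Longrightarrow> burge_prod L N a b = 0"
  by (rule burge_prod_eq_0) auto

lemma burge_prod_uminus: "burge_prod L N (- a) (- b) = burge_prod L N a b"
  by (simp add: burge_prod_def)

text \<open>In this form \<open>r\<close> has left the upper entries, so that a sum over
  \<open>r\<close> is of q-Vandermonde or q-Saalschuetz type.\<close>

lemma burge_prod_eq_qbinom:
  "burge_prod (L - r) r a b = qbinom q (L + a - b) (L + a - r) * qbinom q (L - a + b) (b + r)"
  using qbinom_sym[of "L - a + b" "b + r"] by (simp add: burge_prod_def algebra_simps)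

text \<open>Since r^2 = b^2 + (r - b)(r + b), the substitution k = L + a - r produces the
  Saalschuetz sum for the values A, B, x, n chosen below. The sign condition serves the degenerate
  case: there |a - b| > L has to force |a + b| > L, so that both sides vanish.\<close>

lemma burge_transform:
  assumes "L \<ge> 0" "N \<ge> 0" "a * b \<ge> 0"
  shows "(\<Sum>r\<in>{0..N}. q powi (r\<^sup>2) * qbinom q (2 * L + N - r) (2 * L) * burge_prod (L - r) r a b)
    = q powi (b\<^sup>2) * burge_prod L N (a + b) b"
proof (cases "\<bar>a - b\<bar> \<le> L \<and> b \<le> N")
  case False
  have "burge_prod (L - r) r a b = 0" if "\<bar>a - b\<bar> > L" for r
    using that by (auto simp: burge_prod_eq_qbinom qbinom_def)
  moreover have "burge_prod (L - r) r a b = 0" if "b > N" "r \<le> N" for r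
    using that by (auto simp: burge_prod_def qbinom_def)
  moreover have "burge_prod L N (a + b) b = 0"
    using False abs_diff_le_abs_add[OF assms(3)] by (intro burge_prod_eq_0) auto
  ultimately show ?thesis using False
    by (auto intro!: sum.neutral)
next
  case True
  define A B x n where "A = L + a - b" and "B = L - a + b" and "x = L + N - a" and "n = L + a + b"
  \<comment> \<open>\<open>{b..A + b}\<close> is the preimage of \<open>{0..A}\<close> under r -> L
    + a - r; the added values of r contribute 0.\<close>
  define R where "R = {0..N} \<union> {b..A + b}"
  have nn: "A \<ge> 0" "B \<ge> 0" "x \<ge> 0" using True by (auto simp: A_def B_def x_def)
  have e: "q powi (r\<^sup>2) = q powi (b\<^sup>2) * q powi ((r - b) * (r + b))" for r
    using q_nonzero by (simp flip: power_int_add) (simp add: algebra_simps power2_eq_square)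
  have "(\<Sum>r\<in>{0..N}. q powi (r\<^sup>2) * qbinom q (2 * L + N - r) (2 * L) * burge_prod (L - r) r a b)
      = (\<Sum>r\<in>R. q powi (r\<^sup>2) * qbinom q (2 * L + N - r) (2 * L) * burge_prod (L - r) r a b)"
  proof (rule sum.mono_neutral_left)
    show "\<forall>r\<in>R - {0..N}. q powi r\<^sup>2 * qbinom q (2 * L + N - r) (2 * L) * burge_prod (L - r) r a b = 0"
    proof
      fix r assume "r \<in> R - {0..N}"
      then consider "r > N" | "r < 0" by fastforce
      then show "q powi r\<^sup>2 * qbinom q (2 * L + N - r) (2 * L) * burge_prod (L - r) r a b = 0"
        by cases (auto simp: qbinom_eq_0 burge_prod_neg)
    qed
  qed (auto simp: R_def)
  also have "\<dots> = q powi (b\<^sup>2) * (\<Sum>r\<in>R. q powi ((r - b) * (r + b)) * qbinom q A (L + a - r)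
      * qbinom q B (b + r) * qbinom q (2 * L + N - r) (2 * L))"
    unfolding sum_distrib_left A_def B_def
    by (rule sum.cong[OF refl], subst e) (simp add: burge_prod_eq_qbinom mult_ac)
  also have "(\<Sum>r\<in>R. q powi ((r - b) * (r + b)) * qbinom q A (L + a - r)
      * qbinom q B (b + r) * qbinom q (2 * L + N - r) (2 * L))
      = (\<Sum>k\<in>(\<lambda>r. L + a - r) ` R. q powi ((A - k) * (n - k)) * qbinom q A k * qbinom q B (n - k)
          * qbinom q (x + k) (A + B))"
    by (subst sum.reindex)
      (auto simp: inj_on_def A_def B_def n_def x_def algebra_simps intro!: sum.cong)
  also have "\<dots> = qbinom q x (A + B - n) * qbinom q (x + n - B) n"
  proof (rule qbinom_Saalschuetz)
    show "{0..A} \<subseteq> (\<lambda>r. L + a - r) ` R"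
      by (auto simp: image_iff R_def A_def intro!: bexI[of _ "L + a - _"])
  qed (use nn in \<open>auto simp: R_def\<close>)
  also have "\<dots> = burge_prod L N (a + b) b"
    by (simp add: burge_prod_def x_def n_def A_def B_def algebra_simps)
  finally show ?thesis .
qed

text \<open>Formally the case N -> infinity: [2L + N - r, 2L] tends to 1/(q;q)_{2L} and
  \<open>burge_prod L N a b\<close> to [2L, L - a]/(q;q)_{2L}, and (q;q)_{2L} cancels. With one
  binomial fewer, Vandermonde replaces Saalschuetz.\<close>

lemma burge_transform_limit:
  assumes "L \<ge> 0" "a * b \<ge> 0"
  shows "(\<Sum>r\<in>{0..L}. q powi (r\<^sup>2) * burge_prod (L - r) r a b)
    = q powi (b\<^sup>2) * qbinom q (2 * L) (L - (a + b))"
proof (cases "\<bar>a - b\<bar> \<le> L")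
  case False
  then have "burge_prod (L - r) r a b = 0" for r
    by (auto simp: burge_prod_eq_qbinom qbinom_def)
  moreover have "qbinom q (2 * L) (L - (a + b)) = 0"
    using False abs_diff_le_abs_add[OF assms(2)] by (auto simp: qbinom_def)
  ultimately show ?thesis by simp
next
  case True
  define A B n where "A = L + a - b" and "B = L - a + b" and "n = L + a + b"
  define R where "R = {0..L} \<union> {b..A + b}"
  have nn: "A \<ge> 0" "B \<ge> 0" using True by (auto simp: A_def B_def)
  have e: "q powi (r\<^sup>2) = q powi (b\<^sup>2) * q powi ((r - b) * (r + b))" for r
    using q_nonzero by (simp flip: power_int_add) (simp add: algebra_simps power2_eq_square)
  have "(\<Sum>r\<in>{0..L}. q powi (r\<^sup>2) * burge_prod (L - r) r a b)
      = (\<Sum>r\<in>R. q powi (r\<^sup>2) * burge_prod (L - r) r a b)"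
    by (rule sum.mono_neutral_left) (use assms in \<open>auto simp: R_def burge_prod_neg\<close>)
  also have "\<dots> = q powi (b\<^sup>2) * (\<Sum>r\<in>R. q powi ((r - b) * (r + b)) * qbinom q A (L + a - r)
      * qbinom q B (b + r))"
    unfolding sum_distrib_left A_def B_def
    by (rule sum.cong[OF refl], subst e) (simp add: burge_prod_eq_qbinom mult_ac)
  also have "(\<Sum>r\<in>R. q powi ((r - b) * (r + b)) * qbinom q A (L + a - r) * qbinom q B (b + r))
      = (\<Sum>k\<in>(\<lambda>r. L + a - r) ` R. q powi ((A - k) * (n - k)) * qbinom q A k * qbinom q B (n - k))"
    by (subst sum.reindex)
      (auto simp: inj_on_def A_def B_def n_def algebra_simps intro!: sum.cong)
  also have "\<dots> = qbinom q (A + B) n"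
  proof (rule qbinom_Vandermonde_int)
    show "{0..A} \<subseteq> (\<lambda>r. L + a - r) ` R"
      by (auto simp: image_iff R_def A_def intro!: bexI[of _ "L + a - _"])
  qed (use nn in \<open>auto simp: R_def\<close>)
  also have "\<dots> = qbinom q (2 * L) (L - (a + b))"
    using qbinom_sym[of "2 * L" "L - (a + b)"] by (simp add: A_def B_def n_def algebra_simps)
  finally show ?thesis .
qed

end

subsection \<open>Alternating sums\<close>

lemma shift_even: "shift k i (2 * s) = (2 * int k + 1) * s"
proof -
  have "(of_int (shift k i (2 * s)) :: rat) = of_int ((2 * int k + 1) * s)"
    unfolding of_int_shift by (simp add: power_int_minus_left)
  then show ?thesis by (simp only: of_int_eq_iff)
qed

lemma shift_odd: "shift k i (2 * s + 1) = (2 * int k + 1) * s + 2 * int k - int i + 1"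
proof -
  have "(of_int (shift k i (2 * s + 1)) :: rat) = of_int ((2 * int k + 1) * s + 2 * int k - int i + 1)"
    unfolding of_int_shift by (simp add: power_int_minus_left field_simps)
  then show ?thesis by (simp only: of_int_eq_iff)
qed

text \<open>The difference k - i is unchanged, so only the coefficient 2k + 1 grows. Together with
  \<open>shift_Suc_Suc\<close> this is exactly the effect of the Burge transform with b = r.\<close>

lemma quad_Suc_Suc: "quad (Suc k) (Suc i) r = quad k i r + r\<^sup>2"
proof -
  have "2 * quad (Suc k) (Suc i) r = 2 * (quad k i r + r\<^sup>2)"
    unfolding distrib_left two_times_quad by (simp add: algebra_simps power2_eq_square)
  then show ?thesis by simp
qed

lemma shift_Suc_Suc: "shift (Suc k) (Suc i) r = shift k i r + r"
proof (cases "even r")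
  case True
  then obtain s where r: "r = 2 * s" by (elim evenE)
  show ?thesis unfolding r shift_even by (simp add: algebra_simps)
next
  case False
  then obtain s where r: "r = 2 * s + 1" by (elim oddE)
  show ?thesis unfolding r shift_odd by (simp add: algebra_simps)
qed

text \<open>Supplies the sign condition of the Burge transform when a is the shift and b = r. The
  bound on i is what r = 1 needs, where the shift is 2k + 1 - i.\<close>

lemma shift_times_nonneg:
  assumes "i \<le> 2 * k + 1"
  shows "shift k i r * r \<ge> 0"
proof (cases "even r")
  case True
  then obtain s where r: "r = 2 * s" by (elim evenE)
  have "(2 * int k + 1) * s * (2 * s) = 2 * ((2 * int k + 1) * (s * s))" by (simp add: mult_ac)
  also have "\<dots> \<ge> 0" by simp
  finally show ?thesis unfolding r shift_even .
next
  case False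
  then obtain s where s: "r = 2 * s + 1" by (elim oddE)
  show ?thesis
  proof (cases "s \<ge> 0")
    case True
    then have "(2 * int k + 1) * s \<ge> 0" by simp
    with True assms show ?thesis unfolding s shift_odd by (intro mult_nonneg_nonneg) linarith+
  next
    case False
    then have "(2 * int k + 1) * s \<le> (2 * int k + 1) * (- 1)"
      by (intro mult_left_mono) auto
    with False show ?thesis unfolding s shift_odd by (simp add: mult_nonpos_nonpos)
  qed
qed

text \<open>At k = 0 the reflection r -> -r swaps i = 0 and i = 1, whose exponents are r(r + 1)/2
  and r(r - 1)/2. \<open>boson_0_0\<close> uses this to read \<open>boson_0_eq\<close> as a
  recursion at i = 0 alone.\<close>

lemma shift_0_1_uminus: "shift 0 1 (- r) = - shift 0 0 r"
proof (cases "even r")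
  case True
  then obtain s where "r = 2 * s" by (elim evenE)
  then show ?thesis using shift_even[of 0 1 "- s"] by (simp add: shift_even)
next
  case False
  then obtain s where r: "r = 2 * s + 1" by (elim oddE)
  have "- r = 2 * (- s - 1) + 1" by (simp add: r)
  then have "shift 0 1 (- r) = - s - 1" by (simp only: shift_odd) simp
  then show ?thesis by (simp add: r shift_odd)
qed

lemma quad_0_1_uminus: "quad 0 1 (- r) = quad 0 0 r"
  by (simp add: quad_def algebra_simps)

lemma quad_even: "quad k i (2 * s) = s * (2 * (2 * int k + 1) * s + 2 * int k - 2 * int i + 1)"
  using two_times_quad[of k i "2 * s"] by (simp add: algebra_simps)

lemma quad_odd: "quad k i (2 * s + 1) = (2 * s + 1) * ((2 * int k + 1) * s + 2 * int k - int i + 1)"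
  using two_times_quad[of k i "2 * s + 1"] by (simp add: algebra_simps)

section \<open>Alternating sums with two length parameters\<close>

context generic_q
begin

text \<open>In the language of physics the alternating side is bosonic and the multiple sum
  fermionic. Truncation to |r| <= N is harmless because \<open>burge_prod\<close> vanishes
  beyond.\<close>

definition boson :: "nat \<Rightarrow> nat \<Rightarrow> int \<Rightarrow> int \<Rightarrow> 'a"
  where "boson k i L N =
    (\<Sum>r\<in>{-N..N}. (-1) powi r * q powi (quad k i r) * burge_prod L N (shift k i r) r)"

lemma boson_superset:
  assumes "finite R" "{-N..N} \<subseteq> R"
  shows "boson k i L N = (\<Sum>r\<in>R. (-1) powi r * q powi (quad k i r) * burge_prod L N (shift k i r) r)"
  unfolding boson_def by (rule sum.mono_neutral_left) (use assms in \<open>auto intro!: burge_prod_eq_0\<close>)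

lemma boson_neg: "L < 0 \<Longrightarrow> boson k i L N = 0"
  by (simp add: boson_def burge_prod_neg)

text \<open>The Burge transform acts on each term, with a the shift and b the summation index, once
  all inner sums have a common range and the order of summation is swapped.\<close>

lemma boson_Suc_Suc:
  assumes "L \<ge> 0" "N \<ge> 0" "i \<le> 2 * k + 1"
  shows "boson (Suc k) (Suc i) L N
    = (\<Sum>r\<in>{0..N}. q powi (r\<^sup>2) * qbinom q (2 * L + N - r) (2 * L) * boson k i (L - r) r)"
proof -
  have "(\<Sum>r\<in>{0..N}. q powi (r\<^sup>2) * qbinom q (2 * L + N - r) (2 * L) * boson k i (L - r) r)
      = (\<Sum>r\<in>{0..N}. \<Sum>b\<in>{-N..N}. (-1) powi b * q powi (quad k i b) *
          (q powi (r\<^sup>2) * qbinom q (2 * L + N - r) (2 * L) * burge_prod (L - r) r (shift k i b) b))"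
    by (intro sum.cong refl, subst boson_superset[where R = "{-N..N}"])
      (auto simp: sum_distrib_left mult_ac)
  also have "\<dots> = (\<Sum>b\<in>{-N..N}. (-1) powi b * q powi (quad k i b) *
      (\<Sum>r\<in>{0..N}. q powi (r\<^sup>2) * qbinom q (2 * L + N - r) (2 * L) * burge_prod (L - r) r (shift k i b) b))"
    by (subst sum.swap) (simp add: sum_distrib_left)
  also have "\<dots> = boson (Suc k) (Suc i) L N"
    unfolding boson_def burge_transform[OF assms(1,2) shift_times_nonneg[OF assms(3)]]
    using q_nonzero by (simp add: shift_Suc_Suc quad_Suc_Suc power_int_add mult_ac)
  finally show ?thesis ..
qed

text \<open>Here the second length disappears and ordinary binomials appear. The free range
  \<open>R\<close> lets one summation set serve all lengths up to a bound, as the Bailey chain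
  requires.\<close>

lemma boson_limit:
  assumes "L \<ge> 0" "i \<le> 2 * k + 1" "finite R" "{-L..L} \<subseteq> R"
  shows "(\<Sum>r\<in>{0..L}. q powi (r\<^sup>2) * boson k i (L - r) r)
    = (\<Sum>b\<in>R. (-1) powi b * q powi (quad (Suc k) (Suc i) b) * qbinom q (2 * L) (L - shift (Suc k) (Suc i) b))"
proof -
  have "(\<Sum>r\<in>{0..L}. q powi (r\<^sup>2) * boson k i (L - r) r)
      = (\<Sum>r\<in>{0..L}. \<Sum>b\<in>R. (-1) powi b * q powi (quad k i b) *
          (q powi (r\<^sup>2) * burge_prod (L - r) r (shift k i b) b))"
  proof (intro sum.cong refl)
    fix r assume "r \<in> {0..L}"
    then have "{-r..r} \<subseteq> R" using assms(4) by auto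
    then show "q powi (r\<^sup>2) * boson k i (L - r) r
      = (\<Sum>b\<in>R. (-1) powi b * q powi (quad k i b) * (q powi (r\<^sup>2) * burge_prod (L - r) r (shift k i b) b))"
      using boson_superset[OF assms(3)] by (simp add: sum_distrib_left mult_ac)
  qed
  also have "\<dots> = (\<Sum>b\<in>R. (-1) powi b * q powi (quad k i b) *
      (\<Sum>r\<in>{0..L}. q powi (r\<^sup>2) * burge_prod (L - r) r (shift k i b) b))"
    by (subst sum.swap) (simp add: sum_distrib_left)
  also have "\<dots> = (\<Sum>b\<in>R. (-1) powi b * q powi (quad (Suc k) (Suc i) b)
      * qbinom q (2 * L) (L - shift (Suc k) (Suc i) b))"
    unfolding burge_transform_limit[OF assms(1) shift_times_nonneg[OF assms(2)]]
    using q_nonzero by (simp add: shift_Suc_Suc quad_Suc_Suc power_int_add mult_ac)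
  finally show ?thesis .
qed

section \<open>Comparison of i = 0 with i = 1, and the start k = 0\<close>

lemma boson_even_odd:
  fixes k :: nat
  assumes "N \<ge> 0"
  defines "K \<equiv> 2 * int k + 1"
  shows "boson k i L N = (\<Sum>s\<in>{-N-1..N+1}.
      q powi (s * (2 * K * s + K - 2 * int i)) * burge_prod L N (K * s) (2 * s)
      - q powi ((2 * s + 1) * (K * s + int i)) * burge_prod L N (K * s + int i) (2 * s + 1))"
proof -
  define S where "S = {-N-1..N+1}"
  define f where "f r = (-1) powi r * q powi (quad k i r) * burge_prod L N (shift k i r) r" for r
  have even: "f (2 * s) = q powi (s * (2 * K * s + K - 2 * int i)) * burge_prod L N (K * s) (2 * s)" for s
    unfolding f_def shift_even quad_even K_def
    by (simp add: power_int_minus_left diff_add_eq add.assoc)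
  \<comment> \<open>Pairing r = 2s with r = -(2s + 1) makes the two shifts K s and K s + i, up to a
    sign that \<open>burge_prod_uminus\<close> absorbs; at i = 0 they coincide.\<close>
  have odd: "f (- (2 * s + 1)) = - (q powi ((2 * s + 1) * (K * s + int i)) * burge_prod L N (K * s + int i) (2 * s + 1))" for s
  proof -
    have r: "- (2 * s + 1) = 2 * (- s - 1) + 1" by simp
    have sh: "shift k i (- (2 * s + 1)) = - (K * s + int i)"
      unfolding r shift_odd by (simp add: K_def algebra_simps)
    have qu: "quad k i (- (2 * s + 1)) = (2 * s + 1) * (K * s + int i)"
      unfolding r quad_odd by (simp add: K_def algebra_simps)
    have "(-1 :: 'a) powi (- (2 * s + 1)) = -1" by (subst power_int_minus_left) simp
    then show ?thesis
      unfolding f_def sh qu burge_prod_uminus by simp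
  qed
  have "boson k i L N = sum f ((\<lambda>s. 2 * s) ` S \<union> (\<lambda>s. - (2 * s + 1)) ` S)"
    unfolding f_def
  proof (rule boson_superset)
    show "{-N..N} \<subseteq> (\<lambda>s. 2 * s) ` S \<union> (\<lambda>s. - (2 * s + 1)) ` S"
    proof
      fix r assume r: "r \<in> {-N..N}"
      show "r \<in> (\<lambda>s. 2 * s) ` S \<union> (\<lambda>s. - (2 * s + 1)) ` S"
      proof (cases "even r")
        case True
        then obtain s where "r = 2 * s" by (elim evenE)
        then show ?thesis using r by (auto simp: S_def)
      next
        case False
        then obtain s where s: "r = 2 * s + 1" by (elim oddE)
        then have "r = - (2 * (- s - 1) + 1)" "- s - 1 \<in> S" using r by (auto simp: S_def)
        then show ?thesis by blast
      qed
    qed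
  qed (simp add: S_def)
  also have "\<dots> = sum f ((\<lambda>s. 2 * s) ` S) + sum f ((\<lambda>s. - (2 * s + 1)) ` S)"
    by (rule sum.union_disjoint) (auto simp: S_def, presburger)
  also have "\<dots> = (\<Sum>s\<in>S. f (2 * s)) + (\<Sum>s\<in>S. f (- (2 * s + 1)))"
    by (simp add: sum.reindex inj_on_def)
  also have "\<dots> = (\<Sum>s\<in>S. f (2 * s) + f (- (2 * s + 1)))"
    by (simp add: sum.distrib)
  finally show ?thesis unfolding even odd S_def by simp
qed

text \<open>After pairing, Pascal's rule reduces each summand of the difference to
  \<open>D s - D (- s)\<close>, and the range of s is symmetric.\<close>

lemma boson_0_eq:
  assumes L: "L \<ge> 1" and N: "N \<ge> 0"
  shows "boson k 0 L N = q powi N * boson k 1 (L - 1) N"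
proof -
  define K where "K = 2 * int k + 1"
  have K: "K \<ge> 1" by (simp add: K_def)
  define D where "D s = q powi (N + L + 2 * K * s\<^sup>2 - 2 * s)
      * (qbinom q (L + N + K * s - 2 * s - 1) (L + K * s - 1) * qbinom q (L + N - K * s + 2 * s - 1) (L - K * s))" for s
  have pair: "(q powi (s * (2 * K * s + K)) * burge_prod L N (K * s) (2 * s)
        - q powi ((2 * s + 1) * (K * s)) * burge_prod L N (K * s) (2 * s + 1))
      - q powi N * (q powi (s * (2 * K * s + K - 2)) * burge_prod (L - 1) N (K * s) (2 * s)
        - q powi ((2 * s + 1) * (K * s + 1)) * burge_prod (L - 1) N (K * s + 1) (2 * s + 1))
      = D s - D (- s)" for s
  proof -
    define a A B where "a = K * s" and "A = L + N + a - 2 * s" and "B = L + N - a + 2 * s"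
    \<comment> \<open>As K >= 1, a and s have the same sign; this excludes the exceptional entries
      0, 0 of Pascal's rule in P1 to P4.\<close>
    have sgn: "a < 0 \<Longrightarrow> s < 0" "a > 0 \<Longrightarrow> s > 0"
      using K by (auto simp: a_def mult_less_0_iff zero_less_mult_iff)
    have sgn': "s < 0 \<Longrightarrow> a < 0"
      using K by (auto simp: a_def mult_less_0_iff)
    have P1: "qbinom q A (L + a) = qbinom q (A - 1) (L + a) + q powi (N - 2 * s) * qbinom q (A - 1) (L + a - 1)"
      using qbinom_Pascal'[of A "L + a"] sgn L N by (fastforce simp: A_def algebra_simps)
    have P2: "qbinom q (B + 1) (L - a) = qbinom q B (L - a) + q powi (N + 1 + 2 * s) * qbinom q B (L - a - 1)"
      using qbinom_Pascal'[of "B + 1" "L - a"] sgn L N by (fastforce simp: B_def algebra_simps)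
    have P3: "qbinom q B (L - a) = qbinom q (B - 1) (L - a - 1) + q powi (L - a) * qbinom q (B - 1) (L - a)"
      using qbinom_Pascal[of B "L - a"] sgn L N by (fastforce simp: B_def algebra_simps)
    have P4: "qbinom q B (L - a - 1) = qbinom q (B - 1) (L - a - 2) + q powi (L - a - 1) * qbinom q (B - 1) (L - a - 1)"
      using qbinom_Pascal[of B "L - a - 1"] sgn' L N by (fastforce simp: B_def algebra_simps)
    have T1: "burge_prod L N (K * s) (2 * s) = qbinom q A (L + a) * qbinom q B (L - a)"
      "burge_prod L N (K * s) (2 * s + 1) = qbinom q (A - 1) (L + a) * qbinom q (B + 1) (L - a)"
      "burge_prod (L - 1) N (K * s) (2 * s) = qbinom q (A - 1) (L + a - 1) * qbinom q (B - 1) (L - a - 1)"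
      "burge_prod (L - 1) N (K * s + 1) (2 * s + 1) = qbinom q (A - 1) (L + a) * qbinom q (B - 1) (L - a - 2)"
      by (simp_all add: burge_prod_def A_def B_def a_def algebra_simps)
    have D1: "D s = q powi (N + L + 2 * K * s\<^sup>2 - 2 * s) * (qbinom q (A - 1) (L + a - 1) * qbinom q (B - 1) (L - a))"
      "D (- s) = q powi (N + L + 2 * K * s\<^sup>2 + 2 * s) * (qbinom q (B - 1) (L - a - 1) * qbinom q (A - 1) (L + a))"
      by (simp_all add: D_def A_def B_def a_def algebra_simps)
    have E1: "q powi (s * (2 * K * s + K)) * q powi (N - 2 * s) = q powi N * q powi (s * (2 * K * s + K - 2))"
      "q powi (s * (2 * K * s + K)) * q powi (N + 1 + 2 * s) = q powi N * q powi ((2 * s + 1) * (K * s + 1))"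
      "q powi N * q powi (s * (2 * K * s + K - 2)) * q powi (L - a) = q powi (N + L + 2 * K * s\<^sup>2 - 2 * s)"
      "q powi N * q powi ((2 * s + 1) * (K * s + 1)) * q powi (L - a - 1) = q powi (N + L + 2 * K * s\<^sup>2 + 2 * s)"
      using q_nonzero
      by (simp_all flip: power_int_add) (simp_all add: a_def algebra_simps power2_eq_square)
    have E2: "q powi ((2 * s + 1) * (K * s)) = q powi (s * (2 * K * s + K))"
      by (simp add: algebra_simps)
    \<comment> \<open>The algebra with binomials and powers of q as plain variables: the expansions
      of x and w share the product u z, which cancels. Splitting z and y then leaves four products,
      two forming the i = 1 term at length L - 1 and two forming
      \<open>D s - D (- s)\<close>.\<close>
    have main: "(E * (x * z) - E * (u * w)) - QN * (E3 * (v * z1) - E4 * (u * z2)) = D1 * (v * z3) - D2 * (z1 * u)"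
      if "x = u + e1 * v" "w = z + e2 * y" "z = z1 + e3 * z3" "y = z2 + e4 * z1"
        "E * e1 = QN * E3" "E * e2 = QN * E4" "QN * E3 * e3 = D1" "QN * E4 * e4 = D2"
      for E x z u w QN E3 v z1 E4 z2 D1 z3 D2 e1 e2 e3 e4 y :: 'a
    proof -
      have "(E * (x * z) - E * (u * w)) = (E * e1) * (v * z) - (E * e2) * (u * y)"
        unfolding that(1,2) by (simp add: algebra_simps)
      also have "\<dots> = QN * E3 * (v * (z1 + e3 * z3)) - QN * E4 * (u * (z2 + e4 * z1))"
        using that(3,4) unfolding that(5,6) by simp
      also have "\<dots> = QN * (E3 * (v * z1) - E4 * (u * z2)) + (QN * E3 * e3) * (v * z3) - (QN * E4 * e4) * (z1 * u)"
        by (simp add: algebra_simps)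
      finally show ?thesis unfolding that(7,8) by simp
    qed
    show ?thesis
      unfolding T1 D1 E2
      by (rule main[OF P1 P2 P3 P4 E1])
  qed
  have "boson k 0 L N - q powi N * boson k 1 (L - 1) N = (\<Sum>s\<in>{-N-1..N+1}. D s - D (- s))"
    unfolding boson_even_odd[OF N] pair[symmetric] K_def
    by (simp add: sum_subtractf flip: sum_distrib_left)
  also have "\<dots> = (\<Sum>s\<in>{-N-1..N+1}. D s) - (\<Sum>s\<in>{-N-1..N+1}. D (- s))"
    by (rule sum_subtractf)
  also have "(\<Sum>s\<in>{-N-1..N+1}. D (- s)) = (\<Sum>s\<in>{-N-1..N+1}. D s)"
    by (rule sum.reindex_bij_witness[of _ uminus uminus]) auto
  finally show ?thesis by simp
qed

text \<open>This covers L = 0, out of reach of \<open>boson_0_eq\<close>. A nonzero shift exceeds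
  the length 0, so only r = 0 and r = -1 remain; their terms are 1 and -[N + 1, 0][N - 1, 0], and
  the second vanishes precisely for N = 0.\<close>

lemma boson_0_at_0:
  assumes "N \<ge> 0"
  shows "boson k 0 0 N = (if N = 0 then 1 else 0)"
proof -
  define f where "f r = (-1) powi r * q powi (quad k 0 r) * burge_prod 0 N (shift k 0 r) r" for r
  \<comment> \<open>The index -1 is added by hand because \<open>{-N..N}\<close> misses it when N =
    0.\<close>
  have "boson k 0 0 N = sum f ({-N..N} \<union> {-1, 0})"
    unfolding f_def by (rule boson_superset) auto
  also have "\<dots> = sum f {-1, 0}"
  proof (rule sum.mono_neutral_right)
    show "\<forall>r\<in>{-N..N} \<union> {-1, 0} - {-1, 0}. f r = 0"
    proof
      fix r assume r: "r \<in> {-N..N} \<union> {-1, 0} - {-1, 0}"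
      have "shift k 0 r \<noteq> 0"
      proof (cases "even r")
        case True
        then obtain s where "r = 2 * s" by (elim evenE)
        moreover have "2 * int k + 1 \<noteq> 0" by linarith
        ultimately show ?thesis using r by (simp add: shift_even)
      next
        case False
        then obtain s where s: "r = 2 * s + 1" by (elim oddE)
        have "shift k 0 r = (2 * int k + 1) * (s + 1)"
          unfolding s shift_odd by (simp add: algebra_simps)
        moreover have "2 * int k + 1 \<noteq> 0" by linarith
        ultimately show ?thesis using r s by simp
      qed
      then show "f r = 0" unfolding f_def by (simp add: burge_prod_eq_0)
    qed
  qed auto
  also have "\<dots> = 1 - burge_prod 0 N 0 (-1)"
    using shift_even[of k 0 0] shift_odd[of k 0 "-1"] assms
    by (simp add: f_def quad_def burge_prod_def qbinom_0_right)
  also have "\<dots> = (if N = 0 then 1 else 0)"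
    using assms by (auto simp: burge_prod_def qbinom_0_right)
  finally show ?thesis .
qed

lemma boson_0_1_eq: "boson 0 1 L N = boson 0 0 L N"
proof -
  have "(-1) powi (- r) * q powi (quad 0 1 (- r)) * burge_prod L N (shift 0 1 (- r)) (- r)
      = (-1) powi r * q powi (quad 0 0 r) * burge_prod L N (shift 0 0 r) r" for r
    unfolding shift_0_1_uminus quad_0_1_uminus burge_prod_uminus by (simp add: power_int_minus_left)
  note this[of "- _", unfolded minus_minus]
  then show ?thesis
    unfolding boson_def
    by (intro sum.reindex_bij_witness[of _ uminus uminus]) auto
qed

text \<open>By the reflection at k = 0, \<open>boson_0_eq\<close> lowers L by one at the cost of a
  factor q^N, and the descent ends at \<open>boson_0_at_0\<close>.\<close>

lemma boson_0_0:
  assumes "N \<ge> 0"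
  shows "boson 0 0 (int l) N = (if N = 0 then 1 else 0)"
proof (induction l)
  case 0
  then show ?case using boson_0_at_0[OF assms] by simp
next
  case (Suc l)
  then show ?case using boson_0_eq[of "int (Suc l)" N 0] assms by (simp add: boson_0_1_eq[simplified])
qed

text \<open>One Burge transform of the Kronecker delta in \<open>boson_0_0\<close>: only r = 0
  survives. This starts the induction of \<open>fermion_eq_boson\<close>.\<close>

lemma boson_1_1:
  assumes "L \<ge> 0" "N \<ge> 0"
  shows "boson 1 1 L N = qbinom q (2 * L + N) (2 * L)"
proof -
  have *: "boson 0 0 (L - r) r = (if r = 0 then 1 else 0)" if "r \<ge> 0" for r
    using boson_0_0[of r "nat (L - r)"] boson_neg[of "L - r" 0 0 r] that assms by (cases "r \<le> L") auto
  have "boson 1 1 L N = (\<Sum>r\<in>{0..N}. q powi (r\<^sup>2) * qbinom q (2 * L + N - r) (2 * L) * boson 0 0 (L - r) r)"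
    using boson_Suc_Suc[of L N 0 0] assms by simp
  also have "\<dots> = (\<Sum>r\<in>{0..N}. if r = 0 then qbinom q (2 * L + N) (2 * L) else 0)"
    by (intro sum.cong refl) (auto simp: *)
  also have "\<dots> = qbinom q (2 * L + N) (2 * L)" using assms by simp
  finally show ?thesis .
qed

end

subsection \<open>Multiple sums over tuples\<close>

text \<open>Bounding the largest entry makes the set finite, so that \<open>sum'\<close> can be
  traded for an ordinary sum; \<open>bounded_incr\<close> does the same at the other end.\<close>

definition bounded_decr :: "nat \<Rightarrow> nat \<Rightarrow> (nat \<Rightarrow> nat) set"
  where "bounded_decr l b = {\<nu> \<in> decr_tuples l. \<nu> 1 \<le> b}"

definition bounded_incr :: "nat \<Rightarrow> nat \<Rightarrow> (nat \<Rightarrow> nat) set"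
  where "bounded_incr l b = {m \<in> incr_tuples l. m l \<le> b}"

definition tuple_cons :: "nat \<Rightarrow> (nat \<Rightarrow> nat) \<Rightarrow> nat \<Rightarrow> nat"
  where "tuple_cons r \<nu> j = (if j = 0 then 0 else if j = 1 then r else \<nu> (j - 1))"

lemma tuple_cons_simps [simp]:
  "tuple_cons r \<nu> 0 = 0" "tuple_cons r \<nu> (Suc 0) = r" "j \<ge> 1 \<Longrightarrow> tuple_cons r \<nu> (Suc j) = \<nu> j"
  by (auto simp: tuple_cons_def)

lemma decr_tuples_outside: "\<nu> \<in> decr_tuples l \<Longrightarrow> j = 0 \<or> j > l \<Longrightarrow> \<nu> j = 0"
  by (auto simp: decr_tuples_def)

lemma decr_tuples_Suc: "\<nu> \<in> decr_tuples l \<Longrightarrow> j \<ge> 1 \<Longrightarrow> \<nu> (Suc j) \<le> \<nu> j"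
  by (cases "j < l") (auto simp: decr_tuples_def)

lemma decr_tuples_le_first: "\<nu> \<in> decr_tuples l \<Longrightarrow> \<nu> j \<le> \<nu> 1"
proof (induction j)
  case (Suc j)
  then show ?case using decr_tuples_Suc[of \<nu> l j] by (cases "j = 0") auto
qed (simp add: decr_tuples_def)

lemma incr_tuples_le_last: "m \<in> incr_tuples l \<Longrightarrow> j \<in> {1..l} \<Longrightarrow> m j \<le> m l"
proof -
  assume m: "m \<in> incr_tuples l" and j: "j \<in> {1..l}"
  from j have "j \<le> l" by simp
  then show ?thesis using m j
    by (induction rule: inc_induct) (auto simp: incr_tuples_def intro: le_trans)
qed

lemma finite_bounded_decr: "finite (bounded_decr l b)"
  by (rule finite_subset[OF _ finite_bounded_tuples[of l b]])
    (auto simp: bounded_decr_def decr_tuples_outside not_le intro: order_trans[OF decr_tuples_le_first])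

lemma finite_bounded_incr: "finite (bounded_incr l b)"
  by (rule finite_subset[OF _ finite_bounded_tuples[of l b]])
    (auto simp: bounded_incr_def incr_tuples_def intro: order_trans[OF incr_tuples_le_last])

lemma decr_tuples_0: "decr_tuples 0 = {\<lambda>_. 0}"
  by (auto simp: decr_tuples_def)

lemma incr_tuples_0: "incr_tuples 0 = {\<lambda>_. 0}"
  by (auto simp: incr_tuples_def)

lemma tuple_cons_in: "\<nu> \<in> bounded_decr l r \<Longrightarrow> tuple_cons r \<nu> \<in> decr_tuples (Suc l)"
proof -
  assume \<nu>: "\<nu> \<in> bounded_decr l r"
  have "tuple_cons r \<nu> j = 0" if "j \<notin> {1..Suc l}" for j
    using \<nu> that by (cases j) (auto simp: bounded_decr_def decr_tuples_def)
  moreover have "tuple_cons r \<nu> (j + 1) \<le> tuple_cons r \<nu> j" if j: "j \<in> {1..<Suc l}" for j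
  proof (cases "j = 1")
    case False
    then obtain j' where "j = Suc j'" "j' \<ge> 1" using j by (cases j) auto
    then show ?thesis using \<nu> by (auto simp: bounded_decr_def intro: decr_tuples_Suc)
  qed (use \<nu> in \<open>simp add: bounded_decr_def\<close>)
  ultimately show ?thesis unfolding decr_tuples_def by blast
qed

lemma sum_bounded_decr_Suc:
  "(\<Sum>\<nu>\<in>bounded_decr (Suc l) b. f \<nu>) = (\<Sum>r\<le>b. \<Sum>\<nu>\<in>bounded_decr l r. f (tuple_cons r \<nu>))"
proof -
  have "(\<Sum>r\<le>b. \<Sum>\<nu>\<in>bounded_decr l r. f (tuple_cons r \<nu>))
      = (\<Sum>(r, \<nu>)\<in>(SIGMA r:{..b}. bounded_decr l r). f (tuple_cons r \<nu>))"
    by (rule sum.Sigma) (auto simp: finite_bounded_decr)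
  also have "\<dots> = (\<Sum>\<nu>\<in>bounded_decr (Suc l) b. f \<nu>)"
  proof (rule sum.reindex_bij_witness[of _ "\<lambda>\<nu>. (\<nu> 1, \<lambda>j. if j = 0 then 0 else \<nu> (Suc j))"
        "\<lambda>(r, \<nu>). tuple_cons r \<nu>"])
    fix x assume "x \<in> (SIGMA r:{..b}. bounded_decr l r)"
    then obtain r \<nu> where x: "x = (r, \<nu>)" "r \<le> b" and \<nu>: "\<nu> \<in> bounded_decr l r" by auto
    then show "(case x of (r, \<nu>) \<Rightarrow> tuple_cons r \<nu>) \<in> bounded_decr (Suc l) b"
      using tuple_cons_in[OF \<nu>] by (simp add: bounded_decr_def)
    have "\<nu> 0 = 0" using \<nu> by (auto simp: bounded_decr_def decr_tuples_outside)
    then show "((case x of (r, \<nu>) \<Rightarrow> tuple_cons r \<nu>) 1,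
        \<lambda>j. if j = 0 then 0 else (case x of (r, \<nu>) \<Rightarrow> tuple_cons r \<nu>) (Suc j)) = x"
      by (auto simp: x)
  next
    fix \<nu> assume \<nu>: "\<nu> \<in> bounded_decr (Suc l) b"
    then have "\<nu> 0 = 0" by (auto simp: bounded_decr_def decr_tuples_outside)
    then show "(case (\<nu> 1, \<lambda>j. if j = 0 then 0 else \<nu> (Suc j)) of (r, \<nu>) \<Rightarrow> tuple_cons r \<nu>) = \<nu>"
      by (auto simp: tuple_cons_def fun_eq_iff)
    show "(\<nu> 1, \<lambda>j. if j = 0 then 0 else \<nu> (Suc j)) \<in> (SIGMA r:{..b}. bounded_decr l r)"
      using \<nu> decr_tuples_Suc[of \<nu> "Suc l" 1] by (auto simp: bounded_decr_def decr_tuples_def)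
  qed auto
  finally show ?thesis ..
qed

lemma sum_bounded_incr_Suc:
  "(\<Sum>m\<in>bounded_incr (Suc l) b. f m) = (\<Sum>x\<le>b. \<Sum>m\<in>bounded_incr l x. f (m(Suc l := x)))"
proof -
  have "(\<Sum>x\<le>b. \<Sum>m\<in>bounded_incr l x. f (m(Suc l := x)))
      = (\<Sum>(x, m)\<in>(SIGMA x:{..b}. bounded_incr l x). f (m(Suc l := x)))"
    by (rule sum.Sigma) (auto simp: finite_bounded_incr)
  also have "\<dots> = (\<Sum>m\<in>bounded_incr (Suc l) b. f m)"
  proof (rule sum.reindex_bij_witness[of _ "\<lambda>m. (m (Suc l), m(Suc l := 0))" "\<lambda>(x, m). m(Suc l := x)"])
    fix z assume "z \<in> (SIGMA x:{..b}. bounded_incr l x)"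
    then obtain x m where z: "z = (x, m)" "x \<le> b" and m: "m \<in> bounded_incr l x" by auto
    have "m (Suc l) = 0" using m by (simp add: bounded_incr_def incr_tuples_def)
    then show "((case z of (x, m) \<Rightarrow> m(Suc l := x)) (Suc l), (case z of (x, m) \<Rightarrow> m(Suc l := x))(Suc l := 0)) = z"
      by (auto simp: z fun_eq_iff)
    show "(case z of (x, m) \<Rightarrow> m(Suc l := x)) \<in> bounded_incr (Suc l) b"
      using m z less_antisym by (fastforce simp: bounded_incr_def incr_tuples_def)
  next
    fix m assume m: "m \<in> bounded_incr (Suc l) b"
    have "m l \<le> m (Suc l)"
      using m by (cases "l = 0") (auto simp: bounded_incr_def incr_tuples_def)
    then show "(m (Suc l), m(Suc l := 0)) \<in> (SIGMA x:{..b}. bounded_incr l x)"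
      using m by (auto simp: bounded_incr_def incr_tuples_def)
  qed auto
  finally show ?thesis ..
qed

section \<open>The inner multiple sum and its recursion\<close>

context generic_q
begin

text \<open>Summand of the inner sum for l = k - 1 and M = m_1. \<open>M\<close> is an integer
  because splitting off variables can lower it below 0.\<close>

definition fermi_term :: "nat \<Rightarrow> nat \<Rightarrow> int \<Rightarrow> (nat \<Rightarrow> nat) \<Rightarrow> 'a"
  where "fermi_term l i M \<nu> =
    q ^ ((\<Sum>j=1..l. (\<nu> j)\<^sup>2) + (\<Sum>j=i..l. \<nu> j))
    * (\<Prod>j=1..l.
         qbinom' q
           (2 * M - 2 * (\<Sum>a=1..j-1. int (\<nu> a)) - int (\<nu> j) - int (\<nu> (j + 1)) - 2 * \<alpha> i j)
           (int (\<nu> j) - int (\<nu> (j + 1))))"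

text \<open>The extra binomial is the first factor belonging to a longer tuple whose largest entry
  is fixed to N. So this is what remains after splitting off n_1 = N, and N matches the second
  length of \<open>boson\<close>.\<close>

definition fermion :: "nat \<Rightarrow> nat \<Rightarrow> int \<Rightarrow> nat \<Rightarrow> 'a"
  where "fermion l i L N = (\<Sum>\<nu>\<in>bounded_decr l N.
    qbinom' q (2 * L + int N - int (\<nu> 1)) (int N - int (\<nu> 1)) * fermi_term l i L \<nu>)"

text \<open>For i > 1 the index shift gives alpha_{i,j+1} = alpha_{i-1,j}. For i = 1 the index
  cannot drop further; instead n_1 enters the linear exponent and alpha_{1,j+1} = alpha_{1,j} + 1,
  which together account for \<open>e\<close>.\<close>

lemma fermi_term_cons:
  assumes "i \<ge> 1"
  defines "e \<equiv> if i = 1 then 1 else 0 :: nat"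
  shows "fermi_term (Suc l) i M (tuple_cons r \<nu>) = q ^ (r\<^sup>2 + e * r)
    * (qbinom' q (2 * (M - int r - int e) + int r - int (\<nu> 1)) (int r - int (\<nu> 1))
      * fermi_term l (max 1 (i - 1)) (M - int r - int e) \<nu>)"
proof -
  have sq: "(\<Sum>j=1..Suc l. (tuple_cons r \<nu> j)\<^sup>2) = r\<^sup>2 + (\<Sum>j=1..l. (\<nu> j)\<^sup>2)"
    by (subst sum.atLeast_Suc_atMost) (auto simp: sum.shift_bounds_cl_Suc_ivl simp del: sum.cl_ivl_Suc intro!: sum.cong)
  have lin: "(\<Sum>j=i..Suc l. tuple_cons r \<nu> j) = e * r + (\<Sum>j=max 1 (i - 1)..l. \<nu> j)"
  proof (cases "i = 1")
    case True
    then show ?thesis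
      by (subst sum.atLeast_Suc_atMost)
        (auto simp: e_def sum.shift_bounds_cl_Suc_ivl simp del: sum.cl_ivl_Suc intro!: sum.cong)
  next
    case False
    then obtain i' where i': "i = Suc i'" "i' \<ge> 1" using assms by (cases i) auto
    show ?thesis
      unfolding i'(1) sum.shift_bounds_cl_Suc_ivl using i' by (auto simp: e_def max_def intro!: sum.cong)
  qed
  have tail: "(\<Sum>a=1..Suc j-1. int (tuple_cons r \<nu> a)) = int r + (\<Sum>a=1..j-1. int (\<nu> a))" if j: "j \<ge> 1" for j
  proof -
    obtain j' where "j = Suc j'" using j by (cases j) auto
    then show ?thesis
      by (simp del: sum.cl_ivl_Suc, subst sum.atLeast_Suc_atMost)
        (auto simp: sum.shift_bounds_cl_Suc_ivl simp del: sum.cl_ivl_Suc intro!: sum.cong)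
  qed
  have al: "\<alpha> i (Suc j) = \<alpha> (max 1 (i - 1)) j + int e" if "j \<ge> 1" for j
    using assms that by (auto simp: \<alpha>_def)
  have al1: "\<alpha> i 1 = int e" using assms by (auto simp: \<alpha>_def)
  define B where "B j = qbinom' q (2 * M - 2 * (\<Sum>a=1..j-1. int (tuple_cons r \<nu> a))
      - int (tuple_cons r \<nu> j) - int (tuple_cons r \<nu> (j + 1)) - 2 * \<alpha> i j)
      (int (tuple_cons r \<nu> j) - int (tuple_cons r \<nu> (j + 1)))" for j
  have "prod B {1..Suc l} = B 1 * (\<Prod>j=1..l. B (Suc j))"
    by (subst prod.atLeast_Suc_atMost) (auto simp: prod.shift_bounds_cl_Suc_ivl simp del: prod.cl_ivl_Suc)
  also have "B 1 = qbinom' q (2 * (M - int r - int e) + int r - int (\<nu> 1)) (int r - int (\<nu> 1))"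
    using al1 by (simp add: B_def algebra_simps)
  also have "(\<Prod>j=1..l. B (Suc j)) = (\<Prod>j=1..l. qbinom' q
      (2 * (M - int r - int e) - 2 * (\<Sum>a=1..j-1. int (\<nu> a)) - int (\<nu> j) - int (\<nu> (j + 1)) - 2 * \<alpha> (max 1 (i - 1)) j)
      (int (\<nu> j) - int (\<nu> (j + 1))))"
  proof (intro prod.cong refl)
    fix j assume "j \<in> {1..l}"
    then have j: "j \<ge> 1" by simp
    show "B (Suc j) = qbinom' q
      (2 * (M - int r - int e) - 2 * (\<Sum>a=1..j-1. int (\<nu> a)) - int (\<nu> j) - int (\<nu> (j + 1)) - 2 * \<alpha> (max 1 (i - 1)) j)
      (int (\<nu> j) - int (\<nu> (j + 1)))"
      unfolding B_def tail[OF j] al[OF j] using j by (simp add: algebra_simps)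
  qed
  finally show ?thesis
    unfolding fermi_term_def B_def[symmetric] sq lin by (simp add: power_add mult_ac)
qed

lemma sum_fermi_term_Suc:
  assumes "i \<ge> 1"
  defines "e \<equiv> if i = 1 then 1 else 0 :: nat"
  shows "(\<Sum>\<nu>\<in>bounded_decr l r. fermi_term (Suc l) i M (tuple_cons r \<nu>))
    = q ^ (r\<^sup>2 + e * r) * fermion l (max 1 (i - 1)) (M - int r - int e) r"
  unfolding fermion_def fermi_term_cons[OF assms(1)] e_def by (simp add: sum_distrib_left)

lemma fermion_0: "fermion 0 i L N = qbinom' q (2 * L + int N) (int N)"
proof -
  have "bounded_decr 0 N = {\<lambda>_. 0}" by (auto simp: bounded_decr_def decr_tuples_0)
  moreover have "fermi_term 0 i L (\<lambda>_. 0) = 1"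
    unfolding fermi_term_def sum.neutral_const by simp
  ultimately show ?thesis by (simp add: fermion_def)
qed

lemma fermion_Suc:
  assumes "i \<ge> 1"
  defines "e \<equiv> if i = 1 then 1 else 0 :: nat"
  shows "fermion (Suc l) i L N = (\<Sum>r\<le>N. qbinom' q (2 * L + int N - int r) (int N - int r)
    * (q ^ (r\<^sup>2 + e * r) * fermion l (max 1 (i - 1)) (L - int r - int e) r))"
  unfolding fermion_def[of "Suc l"] sum_bounded_decr_Suc e_def
  using sum_fermi_term_Suc[OF assms(1)]
  by (simp flip: sum_distrib_left)

text \<open>
  For negative \<open>L\<close> the primed binomials force all summation variables to vanish; this is the
  value that makes \<open>boson_0_eq\<close> extend to \<open>L = 0\<close>.
\<close>

lemma fermion_neg: "i \<ge> 1 \<Longrightarrow> L < 0 \<Longrightarrow> fermion l i L N = (if N = 0 then 1 else 0)"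
proof (induction l arbitrary: i L N)
  case 0
  then show ?case by (auto simp: fermion_0 qbinom'_def qbinom_def)
next
  case (Suc l)
  define e :: nat where "e = (if i = 1 then 1 else 0)"
  have "fermion (Suc l) i L N = (\<Sum>r\<le>N. if r = N then q ^ (N\<^sup>2 + e * N) * fermion l (max 1 (i - 1)) (L - int N - int e) N else 0)"
    unfolding fermion_Suc[OF Suc.prems(1)] e_def
    by (intro sum.cong refl) (use Suc.prems in \<open>auto simp: qbinom'_def qbinom_def\<close>)
  also have "\<dots> = (if N = 0 then 1 else 0)"
    using Suc.prems by (simp add: Suc.IH)
  finally show ?case .
qed

text \<open>For i > 1 the induction hypothesis applies with i - 1. For i = 1 it yields q^r times the
  alternating sum with i = 1 at length L - r - 1, which \<open>boson_0_eq\<close> turns into i = 0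
  at length L - r. At the boundary r = L, the value of \<open>fermion_neg\<close> at length -1
  agrees with \<open>boson_0_at_0\<close>.\<close>

lemma fermion_step:
  assumes IH: "\<And>i L N. i \<ge> 1 \<Longrightarrow> i \<le> Suc d \<Longrightarrow> L \<ge> 0 \<Longrightarrow> fermion d i L N = boson (Suc d) i L (int N)"
    and i: "i \<ge> 1" "i \<le> Suc (Suc d)" and L: "L \<ge> 0"
  defines "e \<equiv> if i = 1 then 1 else 0 :: nat"
  shows "q ^ (e * r) * fermion d (max 1 (i - 1)) (L - int r - int e) r = boson (Suc d) (i - 1) (L - int r) (int r)"
proof (cases "i = 1")
  case False
  then have m: "max 1 (i - 1) = i - 1" "e = 0" "i - 1 \<ge> 1" using i by (auto simp: e_def)
  show ?thesis
  proof (cases "int r \<le> L")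
    case True
    then show ?thesis using m i IH[of "i - 1" "L - int r" r] by simp
  next
    case F: False
    then show ?thesis using m L by (simp add: fermion_neg boson_neg)
  qed
next
  case True
  consider "int r < L" | "int r = L" | "int r > L" by linarith
  then show ?thesis
  proof cases
    case 1
    then show ?thesis using True IH[of 1 "L - int r - 1" r] boson_0_eq[of "L - int r" "int r" "Suc d"]
      by (simp add: e_def)
  next
    case 2
    then show ?thesis using True boson_0_at_0[of "int r" "Suc d"] by (auto simp: e_def fermion_neg)
  next
    case 3
    then show ?thesis using True L by (simp add: e_def fermion_neg boson_neg)
  qed
qed

text \<open>Both sides obey one recursion: splitting off the largest variable on the left is a Burge
  transform on the right. A free N closes the induction, since the value r split off becomes the new
  N.\<close>

lemma fermion_eq_boson:
  "i \<ge> 1 \<Longrightarrow> i \<le> Suc d \<Longrightarrow> L \<ge> 0 \<Longrightarrow> fermion d i L N = boson (Suc d) i L (int N)"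
proof (induction d arbitrary: i L N)
  case 0
  then have "i = 1" by simp
  then show ?case
    using 0 boson_1_1[of L "int N"] qbinom_sym[of "2 * L + int N" "int N"]
    by (simp add: fermion_0 qbinom'_def)
next
  case (Suc d)
  define e :: nat where "e = (if i = 1 then 1 else 0)"
  obtain i' where i': "i = Suc i'" using Suc.prems by (cases i) auto
  have "fermion (Suc d) i L N = (\<Sum>r\<le>N. qbinom' q (2 * L + int N - int r) (int N - int r)
      * (q ^ (r\<^sup>2) * (q ^ (e * r) * fermion d (max 1 (i - 1)) (L - int r - int e) r)))"
    unfolding fermion_Suc[OF Suc.prems(1)] e_def by (simp add: power_add mult.assoc)
  also have "\<dots> = (\<Sum>r\<le>N. q powi (int r)\<^sup>2 * qbinom q (2 * L + int N - int r) (2 * L) * boson (Suc d) i' (L - int r) (int r))"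
  proof (intro sum.cong refl)
    fix r assume "r \<in> {..N}"
    \<comment> \<open>Here L >= 0 and r <= N, so the upper entry is nonnegative and the primed
      binomial is the ordinary one.\<close>
    then have "qbinom' q (2 * L + int N - int r) (int N - int r) = qbinom q (2 * L + int N - int r) (2 * L)"
      using Suc.prems qbinom_sym[of "2 * L + int N - int r" "2 * L"] by (auto simp: qbinom'_def algebra_simps)
    moreover have "q ^ (e * r) * fermion d (max 1 (i - 1)) (L - int r - int e) r = boson (Suc d) i' (L - int r) (int r)"
      using fermion_step[of d i L r] Suc.IH Suc.prems i' unfolding e_def by simp
    moreover have "q powi (int r)\<^sup>2 = q ^ (r\<^sup>2)" by (simp flip: of_nat_power)
    ultimately show "qbinom' q (2 * L + int N - int r) (int N - int r)
      * (q ^ (r\<^sup>2) * (q ^ (e * r) * fermion d (max 1 (i - 1)) (L - int r - int e) r))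
      = q powi (int r)\<^sup>2 * qbinom q (2 * L + int N - int r) (2 * L) * boson (Suc d) i' (L - int r) (int r)"
      by simp
  qed
  also have "\<dots> = boson (Suc (Suc d)) i L (int N)"
    using Suc.prems boson_Suc_Suc[of L "int N" i' "Suc d"] by (simp add: i' sum_int_atLeast0)
  finally show ?case .
qed

text \<open>The case p = 0 with M = m_1. No binomial with a second length multiplies the largest
  variable, so the last transform is \<open>boson_limit\<close> instead of
  \<open>boson_Suc_Suc\<close>.\<close>

lemma sum_fermi_term:
  assumes k: "k \<ge> 2" and i: "i \<ge> 1" "i \<le> k" and R: "finite R" "{- int M..int M} \<subseteq> R"
  shows "sum' (fermi_term (k - 1) i (int M)) (decr_tuples (k - 1))
    = (\<Sum>b\<in>R. (-1) powi b * q powi (quad k i b) * qbinom q (2 * int M) (int M - shift k i b))"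
proof -
  obtain d where d: "k = Suc (Suc d)" using k by (metis add_2_eq_Suc le_Suc_ex)
  obtain i' where i': "i = Suc i'" using i by (cases i) auto
  define e :: nat where "e = (if i = 1 then 1 else 0)"
  define S where "S = {\<nu> \<in> decr_tuples (k - 1). fermi_term (k - 1) i (int M) \<nu> \<noteq> 0}"
  have "finite S"
    by (rule finite_subset[OF _ finite_inner_support[of k q M i]])
      (auto simp: S_def fermi_term_def simp del: prod_zero_iff)
  then have "finite ((\<lambda>\<nu>. \<nu> 1) ` S)" by simp
  then obtain b0 where b0: "\<And>x. x \<in> (\<lambda>\<nu>. \<nu> 1) ` S \<Longrightarrow> x \<le> b0"
    using finite_nat_set_iff_bounded_le by auto
  \<comment> \<open>\<open>b0\<close> bounds the first entries in the finite support, which gives a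
    finite sum; b >= M permits the later cut at r = M, beyond which \<open>boson_neg\<close>
    applies.\<close>
  define b where "b = max M b0"
  have "sum' (fermi_term (k - 1) i (int M)) (decr_tuples (k - 1))
      = sum' (fermi_term (k - 1) i (int M)) (bounded_decr (k - 1) b)"
  proof (rule sum.mono_neutral_right')
    show "\<forall>\<nu>\<in>decr_tuples (k - 1) - bounded_decr (k - 1) b. fermi_term (k - 1) i (int M) \<nu> = 0"
      using b0 by (fastforce simp: bounded_decr_def b_def S_def)
  qed (auto simp: bounded_decr_def)
  also have "\<dots> = (\<Sum>\<nu>\<in>bounded_decr (Suc d) b. fermi_term (Suc d) i (int M) \<nu>)"
    by (simp add: d sum.eq_sum finite_bounded_decr)
  also have "\<dots> = (\<Sum>r\<le>b. q ^ (r\<^sup>2) * (q ^ (e * r) * fermion d (max 1 (i - 1)) (int M - int r - int e) r))"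
    unfolding sum_bounded_decr_Suc sum_fermi_term_Suc[OF i(1)] e_def by (simp add: power_add mult.assoc)
  also have "\<dots> = (\<Sum>r\<le>b. q ^ (r\<^sup>2) * boson (Suc d) i' (int M - int r) (int r))"
    using fermion_step[OF fermion_eq_boson, of d i "int M"] i d i' unfolding e_def by simp
  also have "\<dots> = (\<Sum>r\<le>M. q ^ (r\<^sup>2) * boson (Suc d) i' (int M - int r) (int r))"
    by (rule sum.mono_neutral_right) (auto simp: b_def boson_neg)
  also have "\<dots> = (\<Sum>r\<in>{0..int M}. q powi (r\<^sup>2) * boson (Suc d) i' (int M - r) r)"
    by (simp add: sum_int_atLeast0 flip: of_nat_power)
  also have "\<dots> = (\<Sum>b\<in>R. (-1) powi b * q powi (quad k i b) * qbinom q (2 * int M) (int M - shift k i b))"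
    unfolding d i' by (rule boson_limit) (use i R in \<open>auto simp: d i'\<close>)
  finally show ?thesis .
qed

subsection \<open>The Bailey chain\<close>

text \<open>Limit of the q-Vandermonde sum as one upper entry tends to infinity. In the induction
  Pascal's rule raises c to c + 1 in one of two parts, and \<open>inv_qfact_rec\<close> merges the
  results.\<close>

lemma qbinom_inv_qfact_sum:
  "(\<Sum>t\<le>N. q powi (int t * (int t + c)) * qbinom q (int N) (int t) * inv_qfact q (int t + c)) = inv_qfact q (int N + c)"
proof (induction N arbitrary: c)
  case 0
  then show ?case by (simp add: qbinom_0_left)
next
  case (Suc N)
  have P: "qbinom q (int (Suc N)) (int t) = qbinom q (int N) (int t) + q powi (int (Suc N) - int t) * qbinom q (int N) (int t - 1)" for t
    using qbinom_Pascal'[of "int (Suc N)" "int t"] by simp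
  have e: "q powi (int (Suc t) * (int (Suc t) + c)) * q powi (int (Suc N) - int (Suc t))
      = q powi (int (Suc N) + c) * q powi (int t * (int t + (c + 1)))" for t
    using q_nonzero by (simp flip: power_int_add) (simp add: algebra_simps)
  have "(\<Sum>t\<le>Suc N. q powi (int t * (int t + c)) * qbinom q (int (Suc N)) (int t) * inv_qfact q (int t + c))
      = (\<Sum>t\<le>Suc N. q powi (int t * (int t + c)) * qbinom q (int N) (int t) * inv_qfact q (int t + c))
      + (\<Sum>t\<le>Suc N. (q powi (int t * (int t + c)) * q powi (int (Suc N) - int t)) * qbinom q (int N) (int t - 1) * inv_qfact q (int t + c))"
    unfolding P by (simp add: algebra_simps sum.distrib del: sum.atMost_Suc of_nat_Suc)
  also have "(\<Sum>t\<le>Suc N. q powi (int t * (int t + c)) * qbinom q (int N) (int t) * inv_qfact q (int t + c)) = inv_qfact q (int N + c)"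
    using Suc.IH[of c] by (simp add: qbinom_eq_0)
  also have "(\<Sum>t\<le>Suc N. (q powi (int t * (int t + c)) * q powi (int (Suc N) - int t)) * qbinom q (int N) (int t - 1) * inv_qfact q (int t + c))
      = (\<Sum>t\<le>N. (q powi (int (Suc t) * (int (Suc t) + c)) * q powi (int (Suc N) - int (Suc t))) * qbinom q (int N) (int t) * inv_qfact q (int t + (c + 1)))"
    by (subst sum.atMost_Suc_shift) (simp add: qbinom_eq_0 add_ac)
  also have "\<dots> = q powi (int (Suc N) + c) * inv_qfact q (int N + (c + 1))"
    unfolding e Suc.IH[symmetric] by (simp add: sum_distrib_left mult_ac)
  also have "inv_qfact q (int N + c) + q powi (int (Suc N) + c) * inv_qfact q (int N + (c + 1)) = inv_qfact q (int (Suc N) + c)"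
    using inv_qfact_rec[of "int (Suc N) + c"] by (simp add: algebra_simps)
  finally show ?case .
qed

text \<open>The Bailey lemma relative to 1, with both free parameters sent to infinity. Setting m =
  t + j and N = n - j reduces it to \<open>qbinom_inv_qfact_sum\<close> with c = 2j.\<close>

lemma bailey_sum_nat:
  "(\<Sum>m\<le>n. q powi (int m)\<^sup>2 * inv_qfact q (int n - int m) * (inv_qfact q (int m - int j) * inv_qfact q (int m + int j)))
    = q powi (int j)\<^sup>2 * (inv_qfact q (int n - int j) * inv_qfact q (int n + int j))"
proof (cases "j \<le> n")
  case False
  then show ?thesis by (auto simp: inv_qfact_def intro!: sum.neutral)
next
  case True
  define N where "N = n - j"
  have N: "int N = int n - int j" using True by (simp add: N_def)
  have e: "q powi (int (t + j))\<^sup>2 = q powi (int j)\<^sup>2 * q powi (int t * (int t + 2 * int j))" for t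
    using q_nonzero by (simp flip: power_int_add) (simp add: algebra_simps power2_eq_square)
  have b: "inv_qfact q (int n - int (t + j)) * inv_qfact q (int t) = inv_qfact q (int N) * qbinom q (int N) (int t)" for t
  proof -
    have "inv_qfact q (int N) * qpoch q q N = 1" using qpoch_nonzero[of N] by (simp add: inv_qfact_def)
    moreover have "int n - int (t + j) = int N - int t" by (simp add: N)
    ultimately show ?thesis
      unfolding qbinom_eq_inv_qfact[OF of_nat_0_le_iff]
      by (simp only: nat_int mult.assoc[symmetric] mult_1) (simp add: mult.commute)
  qed
  have "(\<Sum>m\<le>n. q powi (int m)\<^sup>2 * inv_qfact q (int n - int m) * (inv_qfact q (int m - int j) * inv_qfact q (int m + int j)))
      = (\<Sum>m\<in>{j..n}. q powi (int m)\<^sup>2 * inv_qfact q (int n - int m) * (inv_qfact q (int m - int j) * inv_qfact q (int m + int j)))"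
    by (rule sum.mono_neutral_right) (auto simp: inv_qfact_def)
  also have "\<dots> = (\<Sum>t\<le>N. q powi (int (t + j))\<^sup>2 * inv_qfact q (int n - int (t + j)) * (inv_qfact q (int (t + j) - int j) * inv_qfact q (int (t + j) + int j)))"
    by (rule sum.reindex_bij_witness[of _ "\<lambda>t. t + j" "\<lambda>m. m - j"]) (use True in \<open>auto simp: N_def\<close>)
  also have "\<dots> = (\<Sum>t\<le>N. q powi (int (t + j))\<^sup>2 * (inv_qfact q (int n - int (t + j)) * inv_qfact q (int t)) * inv_qfact q (int t + 2 * int j))"
    by (simp add: mult_ac add_ac)
  also have "\<dots> = q powi (int j)\<^sup>2 * inv_qfact q (int N) * (\<Sum>t\<le>N. q powi (int t * (int t + 2 * int j)) * qbinom q (int N) (int t) * inv_qfact q (int t + 2 * int j))"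
    unfolding b e by (simp add: sum_distrib_left mult_ac)
  also have "\<dots> = q powi (int j)\<^sup>2 * (inv_qfact q (int n - int j) * inv_qfact q (int n + int j))"
    unfolding qbinom_inv_qfact_sum by (simp add: N add.commute)
  finally show ?thesis .
qed

lemma bailey_sum:
  "(\<Sum>m\<le>n. q powi (int m)\<^sup>2 * inv_qfact q (int n - int m) * (inv_qfact q (int m - a) * inv_qfact q (int m + a)))
    = q powi a\<^sup>2 * (inv_qfact q (int n - a) * inv_qfact q (int n + a))"
proof (cases "a \<ge> 0")
  case True
  then show ?thesis using bailey_sum_nat[of n "nat a"] by simp
next
  case False
  then show ?thesis using bailey_sum_nat[of n "nat (- a)"] by (simp add: mult.commute)
qed

primrec bailey_chain :: "nat \<Rightarrow> (nat \<Rightarrow> 'a) \<Rightarrow> nat \<Rightarrow> 'a"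
  where "bailey_chain 0 f n = f n"
  | "bailey_chain (Suc p) f n = (\<Sum>m\<le>n. q powi (int m)\<^sup>2 * inv_qfact q (int n - int m) * bailey_chain p f m)"

text \<open>\<open>bailey_sum\<close> acts on each term of the expansion separately, once per link
  of the chain. The chain at n only sees m <= n, so the expansion of \<open>f\<close> may use a
  fixed finite \<open>R\<close>.\<close>

lemma bailey_chain_eq:
  assumes "\<And>m. m \<le> n \<Longrightarrow> f m = (\<Sum>r\<in>R. c r * (inv_qfact q (int m - a r) * inv_qfact q (int m + a r)))"
  shows "bailey_chain p f n
    = (\<Sum>r\<in>R. c r * q powi (int p * (a r)\<^sup>2) * (inv_qfact q (int n - a r) * inv_qfact q (int n + a r)))"
  using assms
proof (induction p arbitrary: n)
  case 0
  then show ?case by simp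
next
  case (Suc p)
  have "bailey_chain (Suc p) f n = (\<Sum>m\<le>n. \<Sum>r\<in>R. c r * q powi (int p * (a r)\<^sup>2) *
      (q powi (int m)\<^sup>2 * inv_qfact q (int n - int m) * (inv_qfact q (int m - a r) * inv_qfact q (int m + a r))))"
    using Suc by (simp add: sum_distrib_left mult_ac)
  also have "\<dots> = (\<Sum>r\<in>R. c r * q powi (int p * (a r)\<^sup>2) * (q powi (a r)\<^sup>2 * (inv_qfact q (int n - a r) * inv_qfact q (int n + a r))))"
    by (subst sum.swap) (simp add: bailey_sum flip: sum_distrib_left)
  also have "\<dots> = (\<Sum>r\<in>R. c r * q powi (int (Suc p) * (a r)\<^sup>2) * (inv_qfact q (int n - a r) * inv_qfact q (int n + a r)))"
    using q_nonzero by (simp add: algebra_simps power_int_add)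
  finally show ?case .
qed

text \<open>Once the largest variable has the value x, the denominator linking it to the next
  smaller one plays the part of (q;q)_{n-m_p}, and the rest is the same sum with x for n.\<close>

lemma sum_bounded_incr_eq_bailey_chain:
  "(\<Sum>m\<in>bounded_incr (Suc p) n. q ^ (\<Sum>j=1..Suc p. (m j)\<^sup>2)
      * (inv_qfact q (int n - int (m (Suc p))) * (\<Prod>j=2..Suc p. inv_qfact q (int (m j) - int (m (j - 1))))) * f (m 1))
    = bailey_chain (Suc p) f n"
proof (induction p arbitrary: n)
  case 0
  have "bounded_incr 0 x = {\<lambda>_. 0}" for x by (auto simp: bounded_incr_def incr_tuples_0)
  then show ?case
    unfolding sum_bounded_incr_Suc by (simp flip: of_nat_power)
next
  case (Suc p)
  have "(\<Sum>m\<in>bounded_incr (Suc (Suc p)) n. q ^ (\<Sum>j=1..Suc (Suc p). (m j)\<^sup>2)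
      * (inv_qfact q (int n - int (m (Suc (Suc p)))) * (\<Prod>j=2..Suc (Suc p). inv_qfact q (int (m j) - int (m (j - 1))))) * f (m 1))
      = (\<Sum>x\<le>n. \<Sum>m\<in>bounded_incr (Suc p) x. q powi (int x)\<^sup>2 * inv_qfact q (int n - int x) *
        (q ^ (\<Sum>j=1..Suc p. (m j)\<^sup>2)
      * (inv_qfact q (int x - int (m (Suc p))) * (\<Prod>j=2..Suc p. inv_qfact q (int (m j) - int (m (j - 1))))) * f (m 1)))"
    unfolding sum_bounded_incr_Suc[where l = "Suc p"]
  proof (intro sum.cong refl)
    fix x and m :: "nat \<Rightarrow> nat"
    define m' where "m' = m(Suc (Suc p) := x)"
    have m': "m' j = m j" if "j \<le> Suc p" for j using that by (simp add: m'_def)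
    have "(\<Sum>j=1..Suc (Suc p). (m' j)\<^sup>2) = (\<Sum>j=1..Suc p. (m' j)\<^sup>2) + x\<^sup>2"
      by (simp add: m'_def)
    also have "(\<Sum>j=1..Suc p. (m' j)\<^sup>2) = (\<Sum>j=1..Suc p. (m j)\<^sup>2)"
      by (intro sum.cong) (auto simp: m')
    finally have s: "(\<Sum>j=1..Suc (Suc p). (m' j)\<^sup>2) = (\<Sum>j=1..Suc p. (m j)\<^sup>2) + x\<^sup>2" .
    have "(\<Prod>j=2..Suc (Suc p). inv_qfact q (int (m' j) - int (m' (j - 1))))
        = (\<Prod>j=2..Suc p. inv_qfact q (int (m' j) - int (m' (j - 1)))) * inv_qfact q (int x - int (m (Suc p)))"
      by (simp add: m'_def)
    also have "(\<Prod>j=2..Suc p. inv_qfact q (int (m' j) - int (m' (j - 1))))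
        = (\<Prod>j=2..Suc p. inv_qfact q (int (m j) - int (m (j - 1))))"
      by (intro prod.cong) (auto simp: m')
    finally have pr: "(\<Prod>j=2..Suc (Suc p). inv_qfact q (int (m' j) - int (m' (j - 1))))
        = (\<Prod>j=2..Suc p. inv_qfact q (int (m j) - int (m (j - 1)))) * inv_qfact q (int x - int (m (Suc p)))" .
    have x: "m' (Suc (Suc p)) = x" and m1: "m' 1 = m 1" by (simp_all add: m'_def)
    have qx: "q powi (int x)\<^sup>2 = q ^ (x\<^sup>2)" by (simp flip: of_nat_power)
    show "q ^ (\<Sum>j=1..Suc (Suc p). ((m(Suc (Suc p) := x)) j)\<^sup>2)
      * (inv_qfact q (int n - int ((m(Suc (Suc p) := x)) (Suc (Suc p))))
        * (\<Prod>j=2..Suc (Suc p). inv_qfact q (int ((m(Suc (Suc p) := x)) j) - int ((m(Suc (Suc p) := x)) (j - 1)))))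
      * f ((m(Suc (Suc p) := x)) 1)
      = q powi (int x)\<^sup>2 * inv_qfact q (int n - int x) *
        (q ^ (\<Sum>j=1..Suc p. (m j)\<^sup>2)
      * (inv_qfact q (int x - int (m (Suc p))) * (\<Prod>j=2..Suc p. inv_qfact q (int (m j) - int (m (j - 1))))) * f (m 1))"
      unfolding m'_def[symmetric] s pr x m1 qx power_add by (simp only: mult_ac)
  qed
  also have "\<dots> = bailey_chain (Suc (Suc p)) f n"
    by (subst bailey_chain.simps) (simp only: Suc.IH flip: sum_distrib_left)
  finally show ?case .
qed

lemma bailey_chain_fermion_eq_boson:
  fixes n p k i :: nat
  assumes "p \<ge> 1" "k \<ge> 2" "i \<le> k" "i \<ge> 1"
  shows
    "sum' (\<lambda>m.
        q ^ (\<Sum>j=1..p. (m j)\<^sup>2) * qpoch q q (2 * n)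
        * (inv_qfact q (int n - int (m p))
           * (\<Prod>j=2..p. inv_qfact q (int (m j) - int (m (j - 1))))
           * inv_qfact q (2 * int (m 1)))
        * sum' (fermi_term (k - 1) i (int (m 1))) (decr_tuples (k - 1)))
      (incr_tuples p)
     = sum' (\<lambda>r::int.
        (-1) powi r * q powi (quad k i r + int p * (shift k i r)\<^sup>2)
        * qbinom q (2 * int n) (int n - shift k i r))
      UNIV"
proof -
  obtain p' where p': "p = Suc p'" using assms by (cases p) auto
  \<comment> \<open>As [2m, m - a] = (q;q)_{2m}/((q;q)_{m-a}(q;q)_{m+a}), the factor 1/(q;q)_{2m}
    brings the inner sum to the form on which \<open>bailey_sum\<close> acts; the prefactor
    (q;q)_{2n} restores a binomial at the end.\<close>
  define f where "f m = inv_qfact q (2 * int m) * sum' (fermi_term (k - 1) i (int m)) (decr_tuples (k - 1))" for m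
  \<comment> \<open>\<open>R\<close> has to contain \<open>{-m..m}\<close> for all m <= n, for the
    inner sums, and the support of the right-hand side, for the final \<open>sum'\<close>.\<close>
  define R where "R = {- int n..int n} \<union> {r. qbinom q (2 * int n) (int n - shift k i r) \<noteq> 0}"
  have R: "finite R" unfolding R_def using finite_right_support by simp
  define c where "c r = (-1) powi r * q powi (quad k i r)" for r
  have qb: "qbinom q (2 * int m) (int m - a) = qpoch q q (2 * m) * (inv_qfact q (int m - a) * inv_qfact q (int m + a))" for m a
    by (simp add: qbinom_eq_inv_qfact nat_mult_distrib mult_ac)
  have f: "f m = (\<Sum>r\<in>R. c r * (inv_qfact q (int m - shift k i r) * inv_qfact q (int m + shift k i r)))"
    if "m \<le> n" for m
  proof -
    have "inv_qfact q (2 * int m) * qpoch q q (2 * m) = 1"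
      using qpoch_nonzero by (simp add: inv_qfact_def nat_mult_distrib)
    then have cancel: "inv_qfact q (2 * int m) * (x * (qpoch q q (2 * m) * y)) = x * y" for x y
      by (metis mult.assoc mult.left_commute mult_1)
    have "{- int m..int m} \<subseteq> R" using that by (auto simp: R_def)
    then show ?thesis
      unfolding f_def c_def by (simp only: sum_fermi_term[OF assms(2,4,3) R] qb sum_distrib_left cancel)
  qed
  have chain: "bailey_chain p f n = (\<Sum>r\<in>R. c r * q powi (int p * (shift k i r)\<^sup>2)
      * (inv_qfact q (int n - shift k i r) * inv_qfact q (int n + shift k i r)))"
    by (rule bailey_chain_eq) (rule f)
  let ?g = "\<lambda>m. q ^ (\<Sum>j=1..p. (m j)\<^sup>2) * qpoch q q (2 * n)
        * (inv_qfact q (int n - int (m p))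
           * (\<Prod>j=2..p. inv_qfact q (int (m j) - int (m (j - 1))))
           * inv_qfact q (2 * int (m 1)))
        * sum' (fermi_term (k - 1) i (int (m 1))) (decr_tuples (k - 1))"
  have "sum' ?g (incr_tuples p) = sum' ?g (bounded_incr p n)"
    by (rule sum.mono_neutral_right') (auto simp: bounded_incr_def inv_qfact_def)
  also have "\<dots> = (\<Sum>m\<in>bounded_incr p n. ?g m)"
    by (rule sum.eq_sum) (rule finite_bounded_incr)
  also have "\<dots> = qpoch q q (2 * n) * (\<Sum>m\<in>bounded_incr p n. q ^ (\<Sum>j=1..p. (m j)\<^sup>2)
      * (inv_qfact q (int n - int (m p)) * (\<Prod>j=2..p. inv_qfact q (int (m j) - int (m (j - 1))))) * f (m 1))"
    unfolding sum_distrib_left f_def by (intro sum.cong refl) (simp add: mult_ac)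
  also have "\<dots> = qpoch q q (2 * n) * bailey_chain p f n"
    unfolding p' sum_bounded_incr_eq_bailey_chain ..
  also have "\<dots> = (\<Sum>r\<in>R. (-1) powi r * q powi (quad k i r + int p * (shift k i r)\<^sup>2)
        * qbinom q (2 * int n) (int n - shift k i r))"
    unfolding chain qb sum_distrib_left c_def
    using q_nonzero by (simp add: power_int_add mult_ac)
  also have "\<dots> = sum' (\<lambda>r::int. (-1) powi r * q powi (quad k i r + int p * (shift k i r)\<^sup>2)
        * qbinom q (2 * int n) (int n - shift k i r)) R"
    by (rule sum.eq_sum[symmetric]) (rule R)
  also have "\<dots> = sum' (\<lambda>r::int. (-1) powi r * q powi (quad k i r + int p * (shift k i r)\<^sup>2)
        * qbinom q (2 * int n) (int n - shift k i r)) UNIV"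
    by (rule sum.mono_neutral_left') (auto simp: R_def)
  finally show ?thesis .
qed

end

section \<open>The case q = 0\<close>

lemma quad_pos:
  assumes "i \<ge> 1" "i \<le> k" "r \<noteq> 0"
  shows "quad k i r > 0"
proof -
  have "r * ((2 * int k + 1) * r + 2 * int k - 2 * int i + 1) > 0"
  proof (cases "r > 0")
    case True
    then have "(2 * int k + 1) * r > 0" by simp
    with True assms show ?thesis by (intro mult_pos_pos) linarith+
  next
    case False
    then have "(2 * int k + 1) * r \<le> (2 * int k + 1) * (- 1)"
      using assms by (intro mult_left_mono) auto
    then have "(2 * int k + 1) * r \<le> - 2 * int k - 1" by simp
    with False assms show ?thesis by (intro mult_neg_neg) linarith+
  qed
  then show ?thesis using two_times_quad[of k i r] by linarith
qed

lemma inv_qfact_zero: "inv_qfact 0 m = (if m < 0 then 0 else 1)"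
  by (simp add: inv_qfact_def qpoch_def)

lemma qbinom_zero: "qbinom 0 a b = (if 0 \<le> b \<and> b \<le> a then 1 else 0)"
  by (simp add: qbinom_def qpoch_def)

lemma sum'_single:
  assumes "a \<in> A" "\<And>x. x \<in> A \<Longrightarrow> x \<noteq> a \<Longrightarrow> f x = 0"
  shows "sum' f A = f a"
proof -
  have "sum' f A = sum' f {a}" by (rule sum.mono_neutral_right') (use assms in auto)
  then show ?thesis by simp
qed

text \<open>Only terms with exponent 0 survive: the zero tuples on the left and, by
  \<open>quad_pos\<close>, r = 0 on the right. Both sides are 1.\<close>

lemma fermion_eq_boson_q_zero:
  fixes q :: "'a::field" and n p k i :: nat
  assumes "q = 0" "p \<ge> 1" "i \<le> k" "i \<ge> 1"
  shows
    "sum' (\<lambda>m.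
        q ^ (\<Sum>j=1..p. (m j)\<^sup>2) * qpoch q q (2 * n)
        * (inv_qfact q (int n - int (m p))
           * (\<Prod>j=2..p. inv_qfact q (int (m j) - int (m (j - 1))))
           * inv_qfact q (2 * int (m 1)))
        * sum' (\<lambda>\<nu>.
            q ^ ((\<Sum>j=1..k-1. (\<nu> j)\<^sup>2) + (\<Sum>j=i..k-1. \<nu> j))
            * (\<Prod>j=1..k-1.
                 qbinom' q
                   (2 * int (m 1) - 2 * (\<Sum>l=1..j-1. int (\<nu> l)) - int (\<nu> j) - int (\<nu> (j + 1))
                     - 2 * \<alpha> i j)
                   (int (\<nu> j) - int (\<nu> (j + 1)))))
          (decr_tuples (k - 1)))
      (incr_tuples p)
     = sum' (\<lambda>r::int.
        (-1) powi r * q powi (quad k i r + int p * (shift k i r)\<^sup>2)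
        * qbinom q (2 * int n) (int n - shift k i r))
      UNIV" (is "sum' ?g _ = sum' ?h _")
proof -
  have sq: "(\<Sum>j=1..l. (\<nu> j)\<^sup>2) \<noteq> 0" if "\<And>j. j \<notin> {1..l} \<Longrightarrow> \<nu> j = 0" "\<nu> \<noteq> (\<lambda>_. 0)"
    for l and \<nu> :: "nat \<Rightarrow> nat"
  proof
    assume "(\<Sum>j=1..l. (\<nu> j)\<^sup>2) = 0"
    then have "\<forall>j\<in>{1..l}. \<nu> j = 0" by simp
    then have "\<nu> = (\<lambda>_. 0)" using that(1) by (intro ext) blast
    then show False using that(2) by contradiction
  qed
  define inner where "inner \<nu> = q ^ ((\<Sum>j=1..k-1. (\<nu> j)\<^sup>2) + (\<Sum>j=i..k-1. \<nu> j))
      * (\<Prod>j=1..k-1.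
           qbinom' q
             (2 * int 0 - 2 * (\<Sum>l=1..j-1. int (\<nu> l)) - int (\<nu> j) - int (\<nu> (j + 1)) - 2 * \<alpha> i j)
             (int (\<nu> j) - int (\<nu> (j + 1))))" for \<nu>
  have "sum' inner (decr_tuples (k - 1)) = inner (\<lambda>_. 0)"
  proof (rule sum'_single)
    fix \<nu> assume "\<nu> \<in> decr_tuples (k - 1)" "\<nu> \<noteq> (\<lambda>_. 0)"
    then have "(\<Sum>j=1..k-1. (\<nu> j)\<^sup>2) \<noteq> 0" by (intro sq) (auto simp: decr_tuples_def)
    then show "inner \<nu> = 0"
      unfolding inner_def assms(1) by (simp only: power_add power_0_left) simp
  qed (auto simp: decr_tuples_def)
  also have "\<dots> = 1"
  proof -
    \<comment> \<open>For the zero tuples the upper entry can be negative with lower entry 0, which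
      is where the primed binomial is 1 by convention.\<close>
    have "qbinom' q (- (2 * \<alpha> i j)) 0 = 1" for j
      using assms(1) by (auto simp: qbinom'_def qbinom_zero \<alpha>_def)
    then show ?thesis by (simp add: inner_def)
  qed
  finally have inner: "sum' inner (decr_tuples (k - 1)) = 1" .
  have "sum' ?g (incr_tuples p) = ?g (\<lambda>_. 0)"
  proof (rule sum'_single)
    fix m assume "m \<in> incr_tuples p" "m \<noteq> (\<lambda>_. 0)"
    then have "(\<Sum>j=1..p. (m j)\<^sup>2) \<noteq> 0" by (intro sq) (auto simp: incr_tuples_def)
    then show "?g m = 0"
      using assms(1) by (simp only: power_0_left) simp
  qed (auto simp: incr_tuples_def)
  moreover have "?g (\<lambda>_. 0) = 1"
    unfolding inner_def[symmetric] inner using assms(1) by (simp add: inv_qfact_zero qpoch_def)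
  moreover have "sum' ?h UNIV = ?h 0"
  proof (rule sum'_single)
    fix r :: int assume "r \<noteq> 0"
    moreover have "int p * (shift k i r)\<^sup>2 \<ge> 0" by simp
    ultimately have "quad k i r + int p * (shift k i r)\<^sup>2 \<noteq> 0"
      using quad_pos[OF assms(4,3), of r] by linarith
    then show "?h r = 0" using assms(1) by simp
  qed simp
  moreover have "?h 0 = 1"
    using shift_even[of k i 0] assms(1) by (simp add: quad_def qbinom_zero)
  ultimately show ?thesis by simp
qed

theorem theorem8p5:
  fixes q :: "'a::field_char_0" and n p k i :: nat
  assumes "\<And>j. j \<ge> 1 \<Longrightarrow> q ^ j \<noteq> 1"
    and "p \<ge> 1" and "k \<in> {2, 3, 4}" and "k > i" and "i \<ge> 1"
  shows
    "sum' (\<lambda>m.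
        q ^ (\<Sum>j=1..p. (m j)\<^sup>2) * qpoch q q (2 * n)
        * (inv_qfact q (int n - int (m p))
           * (\<Prod>j=2..p. inv_qfact q (int (m j) - int (m (j - 1))))
           * inv_qfact q (2 * int (m 1)))
        * sum' (\<lambda>\<nu>.
            q ^ ((\<Sum>j=1..k-1. (\<nu> j)\<^sup>2) + (\<Sum>j=i..k-1. \<nu> j))
            * (\<Prod>j=1..k-1.
                 qbinom' q
                   (2 * int (m 1) - 2 * (\<Sum>l=1..j-1. int (\<nu> l)) - int (\<nu> j) - int (\<nu> (j + 1))
                     - 2 * \<alpha> i j)
                   (int (\<nu> j) - int (\<nu> (j + 1)))))
          (decr_tuples (k - 1)))
      (incr_tuples p)
     = sum' (\<lambda>r::int.
        (-1) powi r * q powi (quad k i r + int p * (shift k i r)\<^sup>2)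
        * qbinom q (2 * int n) (int n - shift k i r))
      UNIV"
proof (cases "q = 0")
  case True
  show ?thesis by (rule fermion_eq_boson_q_zero) (use True assms in auto)
next
  case False
  then interpret generic_q q by unfold_locales (use assms(1) in auto)
  have "k \<ge> 2" "i \<le> k" using assms(3,4) by auto
  from bailey_chain_fermion_eq_boson[OF assms(2) this assms(5)] show ?thesis
    unfolding fermi_term_def .
qed

end
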